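(* Let $(G_N)_{N\ge1}$ be a sequence of generalized random graphs $\mathrm{GRG}_N(\boldsymbol w)$ whose deterministic weights satisfy the weight regularity condition. Then, for all $(\beta,B)\in\mathcal U^{\mathrm{an}}$ and for any $\varepsilon>0$, there exists a number $L=L(\varepsilon)>0$ such that $$\widetilde P_N\Big(\Big|\frac{S_N}{N}-\widetilde M\Big|\ge\varepsilon\Big)\le e^{-NL}\qquad\text{for all sufficiently large }N,$$ where $\widetilde M=\widetilde M(\beta,B)=\lim_{N\to\infty}\widetilde P_N(S_N/N)$ is the limiting annealed magnetization.
   Context: Generalized random graph: for each $N$, let $\boldsymbol w=(w_i)_{i\in[N]}$ be deterministic weights $w_i>0$, $[N]=\{1,\dots,N\}$, and $\ell_N=\sum_{i=1}^N w_i$. In $\mathrm{GRG}_N(\boldsymbol w)$ with vertex set $[N]$, the edges $\{i,j\}$, $i<j$, are present independently with probability $p_{ij}=\frac{w_iw_j}{\ell_N+w_iw_j}$. Let $W_N=w_{I_N}$ with $I_N$ uniform in $[N]$. Weight regularity condition: there is a random variable $W$ such that, as $N\to\infty$, (a) $W_N\to W$ in distribution; (b) $\mathbb E[W_N]=\frac1N\sum_i w_i\to\mathbb E[W]<\infty$; (c) $\mathbb E[W_N^2]=\frac1N\sum_i w_i^2\to\mathbb E[W^2]<\infty$; and $\mathbb E[W]>0$. Annealed Ising model: let $Q_N$ denote the law of the random graph $G_N=([N],E_N)$ and also the corresponding expectation. For $\beta\ge0$, $B\in\mathbb R$ the annealed measure on $\sigma\in\{-1,1\}^N$ is $$\widetilde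 P_N(\sigma)=\frac{Q_N\big(\exp[\beta\sum_{(i,j)\in E_N}\sigma_i\sigma_j+B\sum_{i\in[N]}\sigma_i]\big)}{Q_N(Z_N(\beta,B))},\qquad Z_N(\beta,B)=\sum_{\sigma\in\{-1,1\}^N}\exp\Big[\beta\sum_{(i,j)\in E_N}\sigma_i\sigma_j+B\sum_{i\in[N]}\sigma_i\Big]$$ (each edge counted once). $\widetilde P_N(\cdot)$ also denotes expectation, and $S_N=\sum_{i\in[N]}\sigma_i$ is the total spin. The limit $\widetilde M(\beta,B)=\lim_{N\to\infty}\widetilde P_N(S_N/N)$ exists for $(\beta,B)\in\mathcal U^{\mathrm{an}}$, where $\mathcal U^{\mathrm{an}}=\{(\beta,B):\beta\ge0,\ B\ne0\ \text{ or }\ 0<\beta<\beta_c^{\mathrm{an}},\ B=0\}$ and $\beta_c^{\mathrm{an}}:=\inf\{\beta>0:\lim_{B\to0^+}\widetilde M(\beta,B)>0\}$, which equals $\operatorname{asinh}(\mathbb E[W]/\mathbb E[W^2])$. *)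

theory Defs
  imports "HOL-Probability.Probability"
begin

section \<open>Generalized random graphs\<close>

text \<open>
  The weights form a triangular array: \<open>w N i\<close> is the weight of vertex \<open>i \<in> {1..N}\<close> in the graph
  on \<open>N\<close> vertices; values at other indices \<open>i\<close> are never used.
\<close>

definition total_weight :: "(nat \<Rightarrow> nat \<Rightarrow> real) \<Rightarrow> nat \<Rightarrow> real" where
  "total_weight w N = (\<Sum>i\<in>{1..N}. w N i)"

definition edge_prob :: "(nat \<Rightarrow> nat \<Rightarrow> real) \<Rightarrow> nat \<Rightarrow> nat \<Rightarrow> nat \<Rightarrow> real" where
  "edge_prob w N i j = w N i * w N j / (total_weight w N + w N i * w N j)"

text \<open>The undirected edge between \<open>i\<close> and \<open>j\<close> is represented by the ordered pair \<open>(i, j)\<close> with \<open>i < j\<close>.\<close>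

definition vertex_pairs :: "nat \<Rightarrow> (nat \<times> nat) set" where
  "vertex_pairs N = {(i, j). 1 \<le> i \<and> i < j \<and> j \<le> N}"

definition GRG :: "(nat \<Rightarrow> nat \<Rightarrow> real) \<Rightarrow> nat \<Rightarrow> (nat \<times> nat) set pmf" where
  "GRG w N =
     map_pmf (\<lambda>X. {e. X e})
       (Pi_pmf (vertex_pairs N) False (\<lambda>(i, j). bernoulli_pmf (edge_prob w N i j)))"

section \<open>Weight regularity\<close>

definition weight_law :: "(nat \<Rightarrow> nat \<Rightarrow> real) \<Rightarrow> nat \<Rightarrow> real measure" where
  "weight_law w N = distr (measure_pmf (pmf_of_set {1..N})) borel (w N)"

definition weight_regularity ::
    "(nat \<Rightarrow> nat \<Rightarrow> real) \<Rightarrow> 'a measure \<Rightarrow> ('a \<Rightarrow> real) \<Rightarrow> bool" where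
  "weight_regularity w P W \<longleftrightarrow>
     prob_space P \<and> W \<in> borel_measurable P \<and>
     weak_conv_m (weight_law w) (distr P borel W) \<and>
     integrable P W \<and>
     (\<lambda>N. (\<Sum>i\<in>{1..N}. w N i) / real N) \<longlonglongrightarrow> integral\<^sup>L P W \<and>
     integrable P (\<lambda>x. (W x)\<^sup>2) \<and>
     (\<lambda>N. (\<Sum>i\<in>{1..N}. (w N i)\<^sup>2) / real N) \<longlonglongrightarrow> integral\<^sup>L P (\<lambda>x. (W x)\<^sup>2) \<and>
     integral\<^sup>L P W > 0"

section \<open>The annealed Ising model\<close>

definition spin_configs :: "nat \<Rightarrow> (nat \<Rightarrow> real) set" where
  "spin_configs N = {1..N} \<rightarrow>\<^sub>E {-1, 1}"

definition total_spin :: "nat \<Rightarrow> (nat \<Rightarrow> real) \<Rightarrow> real" where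
  "total_spin N \<sigma> = (\<Sum>i\<in>{1..N}. \<sigma> i)"

definition boltzmann_weight ::
    "nat \<Rightarrow> (nat \<times> nat) set \<Rightarrow> real \<Rightarrow> real \<Rightarrow> (nat \<Rightarrow> real) \<Rightarrow> real" where
  "boltzmann_weight N E \<beta> B \<sigma> = exp (\<beta> * (\<Sum>(i, j)\<in>E. \<sigma> i * \<sigma> j) + B * total_spin N \<sigma>)"

definition partition_function :: "nat \<Rightarrow> (nat \<times> nat) set \<Rightarrow> real \<Rightarrow> real \<Rightarrow> real" where
  "partition_function N E \<beta> B = (\<Sum>\<sigma>\<in>spin_configs N. boltzmann_weight N E \<beta> B \<sigma>)"

definition annealed_weight ::
    "(nat \<Rightarrow> nat \<Rightarrow> real) \<Rightarrow> real \<Rightarrow> real \<Rightarrow> nat \<Rightarrow> (nat \<Rightarrow> real) \<Rightarrow> real" where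
  "annealed_weight w \<beta> B N \<sigma> =
     measure_pmf.expectation (GRG w N) (\<lambda>E. boltzmann_weight N E \<beta> B \<sigma>) /
     measure_pmf.expectation (GRG w N) (\<lambda>E. partition_function N E \<beta> B)"

definition annealed_ising ::
    "(nat \<Rightarrow> nat \<Rightarrow> real) \<Rightarrow> real \<Rightarrow> real \<Rightarrow> nat \<Rightarrow> (nat \<Rightarrow> real) measure" where
  "annealed_ising w \<beta> B N =
     point_measure (spin_configs N) (\<lambda>\<sigma>. ennreal (annealed_weight w \<beta> B N \<sigma>))"

definition annealed_magnetization :: "(nat \<Rightarrow> nat \<Rightarrow> real) \<Rightarrow> real \<Rightarrow> real \<Rightarrow> real" where
  "annealed_magnetization w \<beta> B =
     lim (\<lambda>N. integral\<^sup>L (annealed_ising w \<beta> B N) (\<lambda>\<sigma>. total_spin N \<sigma> / real N))"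

definition annealed_beta_c :: "(nat \<Rightarrow> nat \<Rightarrow> real) \<Rightarrow> real" where
  "annealed_beta_c w =
     Inf {\<beta>. \<beta> > 0 \<and> (\<exists>m>0. (annealed_magnetization w \<beta> \<longlongrightarrow> m) (at_right 0))}"

definition annealed_uniqueness_regime :: "(nat \<Rightarrow> nat \<Rightarrow> real) \<Rightarrow> (real \<times> real) set" where
  "annealed_uniqueness_regime w =
     {(\<beta>, B). (\<beta> \<ge> 0 \<and> B \<noteq> 0) \<or> (0 < \<beta> \<and> \<beta> < annealed_beta_c w \<and> B = 0)}"

section \<open>The annealed measure is a probability measure\<close>

lemma finite_vertex_pairs: "finite (vertex_pairs N)"
  by (rule finite_subset[of _ "{1..N} \<times> {1..N}"]) (auto simp: vertex_pairs_def)

lemma finite_spin_configs: "finite (spin_configs N)"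
  by (auto simp: spin_configs_def intro!: finite_PiE)

lemma spin_configs_nonempty: "spin_configs N \<noteq> {}"
  by (auto simp: spin_configs_def PiE_eq_empty_iff)

lemma set_pmf_GRG: "set_pmf (GRG w N) \<subseteq> Pow (vertex_pairs N)"
proof -
  have "set_pmf (Pi_pmf (vertex_pairs N) False p) \<subseteq> {f. \<forall>x. x \<notin> vertex_pairs N \<longrightarrow> f x = False}"
    for p :: "nat \<times> nat \<Rightarrow> bool pmf"
    by (rule set_Pi_pmf_subset[OF finite_vertex_pairs])
  then show ?thesis
    unfolding GRG_def by fastforce
qed

lemma finite_set_pmf_GRG: "finite (set_pmf (GRG w N))"
  by (rule finite_subset[OF set_pmf_GRG]) (simp add: finite_vertex_pairs)

lemma expectation_boltzmann_weight_pos: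
  "measure_pmf.expectation (GRG w N) (\<lambda>E. boltzmann_weight N E \<beta> B \<sigma>) > 0"
proof -
  have "measure_pmf.expectation (GRG w N) (\<lambda>E. boltzmann_weight N E \<beta> B \<sigma>) =
      (\<Sum>E\<in>set_pmf (GRG w N). pmf (GRG w N) E *\<^sub>R boltzmann_weight N E \<beta> B \<sigma>)"
    by (rule integral_measure_pmf[OF finite_set_pmf_GRG]) auto
  also have "\<dots> > 0"
    by (intro sum_pos finite_set_pmf_GRG set_pmf_not_empty)
       (auto simp: boltzmann_weight_def pmf_positive)
  finally show ?thesis .
qed

lemma expectation_partition_function:
  "measure_pmf.expectation (GRG w N) (\<lambda>E. partition_function N E \<beta> B) =
   (\<Sum>\<sigma>\<in>spin_configs N. measure_pmf.expectation (GRG w N) (\<lambda>E. boltzmann_weight N E \<beta> B \<sigma>))"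
  unfolding partition_function_def
  by (rule Bochner_Integration.integral_sum)
     (rule integrable_measure_pmf_finite[OF finite_set_pmf_GRG])

lemma expectation_partition_function_pos:
  "measure_pmf.expectation (GRG w N) (\<lambda>E. partition_function N E \<beta> B) > 0"
  unfolding expectation_partition_function
  by (intro sum_pos finite_spin_configs spin_configs_nonempty expectation_boltzmann_weight_pos)

lemma annealed_weight_pos: "annealed_weight w \<beta> B N \<sigma> > 0"
  unfolding annealed_weight_def
  by (intro divide_pos_pos expectation_boltzmann_weight_pos expectation_partition_function_pos)

lemma sum_annealed_weight: "(\<Sum>\<sigma>\<in>spin_configs N. annealed_weight w \<beta> B N \<sigma>) = 1"
  using expectation_partition_function_pos[of w N \<beta> B]
  unfolding annealed_weight_def sum_divide_distrib[symmetric]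
  by (simp add: expectation_partition_function[symmetric])

lemma prob_space_annealed_ising: "prob_space (annealed_ising w \<beta> B N)"
  unfolding annealed_ising_def
proof (rule prob_space_point_measure)
  show "(\<Sum>\<sigma>\<in>spin_configs N. ennreal (annealed_weight w \<beta> B N \<sigma>)) = 1"
    by (subst sum_ennreal) (auto simp: sum_annealed_weight less_imp_le[OF annealed_weight_pos])
qed (simp_all add: finite_spin_configs)

end

theory Submission
  imports Defs "HOL-Real_Asymp.Real_Asymp"
begin

text \<open>
  The annealed measure is, up to a factor of subexponential size, an inhomogeneous Curie-Weiss model. Averaging over
  the independent edges turns the Boltzmann weight into \<open>exp (B S)\<close> times a product over the pairs \<open>i < j\<close> of
  \<open>(1 + q exp (\<beta> \<sigma>\<^sub>i \<sigma>\<^sub>j)) / (1 + q)\<close>, where \<open>q = w\<^sub>i w\<^sub>j / l\<close> and \<open>l\<close> is the total weight. To first order in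
  \<open>q\<close> its logarithm is a constant plus
  \<open>sinh \<beta> / (2 l) (\<Sum>\<^sub>i w\<^sub>i \<sigma>\<^sub>i)\<^sup>2 + B S\<close> (\<open>ln_expectation_boltzmann_weight_approx\<close>), and weight regularity makes the
  total error \<open>o(N)\<close> (\<open>intensity_error_negligible\<close>).

  In this model the square is the supremum of its tangents, and a finite family of tangents suffices up to a small error.
  For a single tangent the spins are independent. So the partition function at field \<open>B\<close> grows like \<open>2\<^sup>N\<close> times the
  exponential of \<open>N max\<^sub>u \<Phi>(B, u)\<close>, where
  \<open>\<Phi>(B, u) = E ln cosh (B + r u W) - u\<^sup>2 / 2\<close> and \<open>r\<^sup>2 = sinh \<beta> / E W\<close>
  (\<open>mean_field_partition_lower\<close>, \<open>mean_field_partition_upper\<close>, \<open>empirical_free_energy_tendsto\<close>).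

  If \<open>\<Phi>(B, \<cdot>)\<close> has a unique maximizer \<open>u\<close>, then \<open>max \<Phi>(B, \<cdot>)\<close> is differentiable in \<open>B\<close> with derivative
  \<open>m = E tanh (B + r u W)\<close> (\<open>envelope_upper_bound\<close>). The exponential Chebyshev inequality, in which the tilt is a
  change of \<open>B\<close>, then gives exponential concentration of \<open>S / N\<close> at \<open>m\<close> (\<open>annealed_concentration\<close>).
  Concentration in turn shows that the limit defining the magnetization exists and equals \<open>m\<close>
  (\<open>annealed_magnetization_eq\<close>).

  It remains to see that the maximizer is unique in the whole uniqueness regime. For \<open>B > 0\<close> a maximizer is positive (or
  \<open>r = 0\<close>) and solves \<open>u = r E (W tanh (B + r u W))\<close>, an equation whose right-hand side divided by \<open>u\<close> is strictly
  decreasing; \<open>B < 0\<close> follows by reflection. For \<open>B = 0\<close> the equation has only the zero solution as soon as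
  \<open>r\<^sup>2 E W\<^sup>2 < 1\<close>, and \<open>\<beta>\<close> below the critical value satisfies this: if \<open>r\<^sup>2 E W\<^sup>2 > 1\<close>, then the positive
  maximizers for \<open>B > 0\<close> stay away from 0 as \<open>B\<close> decreases to 0, so \<open>\<beta>\<close> belongs to the set whose infimum defines
  the critical value (\<open>spontaneous_magnetization\<close>, \<open>subcritical_coupling\<close>).
\<close>

section \<open>Hyperbolic functions\<close>

lemma abs_tanh_le_1: "\<bar>tanh x\<bar> \<le> 1" for x :: real
  using tanh_real_bounds[of x] by auto

lemma tanh_mean_value:
  fixes a b :: real
  assumes "a < b"
  obtains z where "a < z" "z < b" "tanh b - tanh a = (b - a) * (1 - (tanh z)\<^sup>2)"
proof -
  have "\<exists>z. a < z \<and> z < b \<and> tanh b - tanh a = (b - a) * (1 - (tanh z)\<^sup>2)"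
    using assms by (intro MVT2) (auto intro!: derivative_eq_intros simp: less_imp_neq)
  with that show thesis by blast
qed

lemma tanh_Lipschitz: "\<bar>tanh a - tanh b\<bar> \<le> \<bar>a - b\<bar>" for a b :: real
proof -
  have *: "\<bar>tanh b - tanh a\<bar> \<le> b - a" if lt: "a < b" for a b :: real
  proof -
    obtain z where z: "tanh b - tanh a = (b - a) * (1 - (tanh z)\<^sup>2)"
      using tanh_mean_value[OF lt] by metis
    have "(tanh z)\<^sup>2 \<le> 1"
      using tanh_real_bounds[of z] by (simp add: abs_square_le_1 abs_le_iff)
    then have "(b - a) * (1 - (tanh z)\<^sup>2) \<le> (b - a) * 1"
      using lt by (intro mult_left_mono) auto
    moreover have "tanh a \<le> tanh b" using lt by simp
    ultimately show ?thesis using z lt by (simp del: tanh_real_le_iff)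
  qed
  show ?thesis
    using *[of a b] *[of b a] by (cases a b rule: linorder_cases) auto
qed

lemma ln_cosh_mean_value:
  fixes a b :: real
  obtains z where "\<bar>z - a\<bar> \<le> \<bar>b - a\<bar>" "0 \<le> (z - a) * (b - a)"
    "ln (cosh b) - ln (cosh a) = (b - a) * tanh z"
proof -
  have d: "((\<lambda>x. ln (cosh x)) has_real_derivative tanh x) (at x)" for x :: real
    by (auto intro!: derivative_eq_intros simp: cosh_real_pos tanh_def)
  show thesis
  proof (cases a b rule: linorder_cases)
    case less
    obtain z where "a < z" "z < b" "ln (cosh b) - ln (cosh a) = (b - a) * tanh z"
      using MVT2[OF less, of "\<lambda>x. ln (cosh x)" tanh] d by blast
    with less show thesis by (intro that[of z]) auto
  next
    case equal
    then show thesis by (intro that[of a]) auto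
  next
    case greater
    obtain z where "b < z" "z < a" "ln (cosh a) - ln (cosh b) = (a - b) * tanh z"
      using MVT2[OF greater, of "\<lambda>x. ln (cosh x)" tanh] d by blast
    with greater show thesis
      by (intro that[of z]) (simp_all add: mult_nonpos_nonpos, simp add: algebra_simps)
  qed
qed

lemma ln_cosh_tangent: "ln (cosh a) + (b - a) * tanh a \<le> ln (cosh b)" for a b :: real
proof -
  obtain z where z: "\<bar>z - a\<bar> \<le> \<bar>b - a\<bar>" "0 \<le> (z - a) * (b - a)"
    "ln (cosh b) - ln (cosh a) = (b - a) * tanh z" by (rule ln_cosh_mean_value)
  have "0 \<le> (b - a) * (tanh z - tanh a)"
  proof (cases "b \<ge> a")
    case True
    with z have "z \<ge> a" by (auto simp: zero_le_mult_iff)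
    with True show ?thesis by simp
  next
    case False
    with z have "z \<le> a" by (auto simp: zero_le_mult_iff)
    with False show ?thesis by (simp add: mult_nonpos_nonpos)
  qed
  with z show ?thesis by (simp add: algebra_simps)
qed

lemma ln_cosh_Taylor: "\<bar>ln (cosh b) - ln (cosh a) - (b - a) * tanh a\<bar> \<le> (b - a)\<^sup>2" for a b :: real
proof -
  obtain z where z: "\<bar>z - a\<bar> \<le> \<bar>b - a\<bar>" "0 \<le> (z - a) * (b - a)"
    "ln (cosh b) - ln (cosh a) = (b - a) * tanh z" by (rule ln_cosh_mean_value)
  have "\<bar>ln (cosh b) - ln (cosh a) - (b - a) * tanh a\<bar> = \<bar>b - a\<bar> * \<bar>tanh z - tanh a\<bar>"
    using z by (simp add: algebra_simps flip: abs_mult)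
  also have "\<dots> \<le> \<bar>b - a\<bar> * \<bar>b - a\<bar>"
    using tanh_Lipschitz[of z a] z by (intro mult_left_mono) auto
  finally show ?thesis by (simp add: power2_eq_square)
qed

lemma ln_cosh_Lipschitz: "\<bar>ln (cosh a) - ln (cosh b)\<bar> \<le> \<bar>a - b\<bar>" for a b :: real
proof -
  obtain z where z: "ln (cosh a) - ln (cosh b) = (a - b) * tanh z" by (rule ln_cosh_mean_value)
  have "\<bar>tanh z\<bar> \<le> 1" using tanh_real_bounds[of z] by auto
  then have "\<bar>a - b\<bar> * \<bar>tanh z\<bar> \<le> \<bar>a - b\<bar> * 1" by (intro mult_left_mono) auto
  with z show ?thesis by (simp add: abs_mult)
qed

lemma ln_cosh_nonneg: "0 \<le> ln (cosh a)" for a :: real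
  by (simp add: cosh_real_ge_1)

lemma ln_cosh_le_abs: "ln (cosh a) \<le> \<bar>a\<bar>" for a :: real
  using ln_cosh_Lipschitz[of a 0] by simp

text \<open>
  Since \<open>tanh\<close> is strictly concave on the positive half-line and nonnegative at \<open>B\<close>, the lines
  from \<open>(B, 0)\<close> to the points of its graph flatten. This is what excludes a second positive solution of the mean-field equation.
\<close>

lemma tanh_over_argument_decreasing:
  fixes B :: real
  assumes "0 \<le> B" "0 < x" "x < y"
  shows "tanh (B + y) / y < tanh (B + x) / x"
proof (rule DERIV_neg_imp_decreasing[OF assms(3)])
  fix z assume z: "x \<le> z" "z \<le> y"
  then have z0: "0 < z" using assms by simp
  have neg: "z * (1 - (tanh (B + z))\<^sup>2) < tanh (B + z)"
  proof -
    have pos: "0 < B + z" using z0 assms by simp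
    obtain \<xi> where \<xi>: "0 < \<xi>" "\<xi> < B + z"
        "tanh (B + z) - tanh 0 = (B + z - 0) * (1 - (tanh \<xi>)\<^sup>2)"
      using tanh_mean_value[OF pos] by blast
    have "0 < tanh \<xi>" "tanh \<xi> < tanh (B + z)" using \<xi>(1,2) by auto
    then have "(tanh \<xi>)\<^sup>2 < (tanh (B + z))\<^sup>2" by (intro power_strict_mono) auto
    moreover have "(tanh (B + z))\<^sup>2 \<le> 1"
      using tanh_real_bounds[of "B + z"] by (simp add: abs_square_le_1 abs_le_iff)
    ultimately have "z * (1 - (tanh (B + z))\<^sup>2) \<le> (B + z) * (1 - (tanh (B + z))\<^sup>2)"
      "(B + z) * (1 - (tanh (B + z))\<^sup>2) < (B + z) * (1 - (tanh \<xi>)\<^sup>2)"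
      using assms(1) pos by (auto intro!: mult_right_mono mult_strict_left_mono)
    with \<xi>(3)[unfolded tanh_0 diff_zero] show ?thesis by linarith
  qed
  have "((\<lambda>z. tanh (B + z) / z) has_real_derivative
      ((1 - (tanh (B + z))\<^sup>2) * z - tanh (B + z)) / (z * z)) (at z)"
    using z0 by (auto intro!: derivative_eq_intros)
  moreover have "((1 - (tanh (B + z))\<^sup>2) * z - tanh (B + z)) / (z * z) < 0"
    using neg z0 by (simp add: divide_neg_pos mult.commute)
  ultimately show "\<exists>D. ((\<lambda>z. tanh (B + z) / z) has_real_derivative D) (at z) \<and> D < 0"
    by blast
qed

lemma cosh_measurable [measurable]: "f \<in> borel_measurable M \<Longrightarrow> (\<lambda>x. cosh (f x :: real)) \<in> borel_measurable M"
  by (rule borel_measurable_continuous_on[where f=cosh]) (auto intro!: continuous_intros)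

lemma tanh_measurable [measurable]: "f \<in> borel_measurable M \<Longrightarrow> (\<lambda>x. tanh (f x :: real)) \<in> borel_measurable M"
  by (rule borel_measurable_continuous_on[where f=tanh]) (auto intro!: continuous_intros simp: less_imp_neq)

section \<open>The limiting free energy\<close>

text \<open>
  \<open>r\<close> stands for \<open>sqrt (sinh \<beta> / E W)\<close>. This normalization, rather than the usual quadratic term with coefficient
  \<open>sinh \<beta> / (2 E W)\<close>, keeps the penalty \<open>u\<^sup>2 / 2\<close> nondegenerate at infinite temperature \<open>\<beta> = 0\<close>.
\<close>

locale limiting_weight = prob_space P
  for P :: "'a measure" +
  fixes W :: "'a \<Rightarrow> real" and r :: real
  assumes W_int [simp, intro]: "integrable P W"
    and W2_int [simp, intro]: "integrable P (\<lambda>x. (W x)\<^sup>2)"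
    and W_nonneg: "AE x in P. 0 \<le> W x"
    and W_mean_pos: "0 < (\<integral>x. W x \<partial>P)"
    and r_nonneg: "0 \<le> r"
begin

definition free_energy :: "real \<Rightarrow> real \<Rightarrow> real" where
  "free_energy B u = (\<integral>x. ln (cosh (B + r * u * W x)) \<partial>P) - u\<^sup>2 / 2"

definition magnetization :: "real \<Rightarrow> real \<Rightarrow> real" where
  "magnetization B u = (\<integral>x. tanh (B + r * u * W x) \<partial>P)"

text \<open>Stationary points of the free energy in \<open>u\<close> are the fixed points of this map.\<close>

definition mean_field :: "real \<Rightarrow> real \<Rightarrow> real" where
  "mean_field B u = r * (\<integral>x. W x * tanh (B + r * u * W x) \<partial>P)"

definition maximizer :: "real \<Rightarrow> real \<Rightarrow> bool" where
  "maximizer B u \<longleftrightarrow> (\<forall>v. free_energy B v \<le> free_energy B u)"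

definition unique_maximizer :: "real \<Rightarrow> real \<Rightarrow> bool" where
  "unique_maximizer B u \<longleftrightarrow> maximizer B u \<and> (\<forall>v. maximizer B v \<longrightarrow> v = u)"

lemma W_measurable [measurable]: "W \<in> borel_measurable P"
  using W_int by (rule borel_measurable_integrable)

lemma ln_cosh_int [simp]: "integrable P (\<lambda>x. ln (cosh (B + c * W x)))"
proof (rule Bochner_Integration.integrable_bound[where f = "\<lambda>x. \<bar>B\<bar> + \<bar>c\<bar> * \<bar>W x\<bar>"])
  show "AE x in P. norm (ln (cosh (B + c * W x))) \<le> norm (\<bar>B\<bar> + \<bar>c\<bar> * \<bar>W x\<bar>)"
  proof (rule AE_I2)
    fix x
    have "\<bar>B + c * W x\<bar> \<le> \<bar>B\<bar> + \<bar>c\<bar> * \<bar>W x\<bar>" by (metis abs_mult abs_triangle_ineq)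
    then show "norm (ln (cosh (B + c * W x))) \<le> norm (\<bar>B\<bar> + \<bar>c\<bar> * \<bar>W x\<bar>)"
      using ln_cosh_le_abs[of "B + c * W x"] ln_cosh_nonneg[of "B + c * W x"] by simp
  qed
qed (auto intro!: Bochner_Integration.integrable_add)

lemma tanh_int [simp]: "integrable P (\<lambda>x. tanh (B + c * W x))"
  by (rule integrable_const_bound[where B=1]) (auto intro!: AE_I2 abs_tanh_le_1)

lemma W_tanh_int [simp]: "integrable P (\<lambda>x. W x * tanh (B + c * W x))"
proof (rule Bochner_Integration.integrable_bound[where f = W])
  show "AE x in P. norm (W x * tanh (B + c * W x)) \<le> norm (W x)"
  proof (rule AE_I2)
    fix x
    have "\<bar>tanh (B + c * W x)\<bar> \<le> 1" by (rule abs_tanh_le_1)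
    then show "norm (W x * tanh (B + c * W x)) \<le> norm (W x)"
      by (simp add: abs_mult mult_left_le)
  qed
qed auto

text \<open>Strict inequalities on the event \<open>W > 0\<close> survive integration, because this event is not null.\<close>

lemma integral_pos_weight:
  fixes f :: "'a \<Rightarrow> real"
  assumes f: "integrable P f" and nn: "AE x in P. 0 \<le> f x"
    and pos: "\<And>x. 0 < W x \<Longrightarrow> 0 < f x"
  shows "0 < (\<integral>x. f x \<partial>P)"
proof -
  have "0 \<le> (\<integral>x. f x \<partial>P)" by (rule integral_nonneg_AE[OF nn])
  moreover have False if "(\<integral>x. f x \<partial>P) = 0"
  proof -
    have "AE x in P. f x = 0" using integral_nonneg_eq_0_iff_AE[OF f nn] that by simp
    then have "AE x in P. W x \<le> 0"
      by eventually_elim (use pos in \<open>force simp: not_le[symmetric]\<close>)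
    then have "(\<integral>x. W x \<partial>P) \<le> (\<integral>x. 0 \<partial>P)" by (intro integral_mono_AE) auto
    with W_mean_pos show False by simp
  qed
  ultimately show ?thesis by fastforce
qed

lemma magnetization_bound: "\<bar>magnetization B u\<bar> \<le> 1"
proof -
  have "\<bar>tanh y\<bar> \<le> 1" for y :: real by (rule abs_tanh_le_1)
  then have "(\<integral>x. norm (tanh (B + r * u * W x)) \<partial>P) \<le> (\<integral>x. 1 \<partial>P)"
    by (intro integral_mono) (auto intro!: integrable_abs)
  then show ?thesis
    unfolding magnetization_def real_norm_def[symmetric]
    by (intro order_trans[OF integral_norm_bound]) (simp add: prob_space)
qed

lemma magnetization_Lipschitz:
  "\<bar>magnetization B u - magnetization B' v\<bar> \<le> \<bar>B - B'\<bar> + r * \<bar>u - v\<bar> * (\<integral>x. W x \<partial>P)"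
proof -
  have "magnetization B u - magnetization B' v
      = (\<integral>x. tanh (B + r * u * W x) - tanh (B' + r * v * W x) \<partial>P)"
    unfolding magnetization_def by (simp add: Bochner_Integration.integral_diff)
  also have "\<bar>\<dots>\<bar> \<le> (\<integral>x. \<bar>tanh (B + r * u * W x) - tanh (B' + r * v * W x)\<bar> \<partial>P)"
    using integral_norm_bound[of P "\<lambda>x. tanh (B + r * u * W x) - tanh (B' + r * v * W x)"] by simp
  also have "\<dots> \<le> (\<integral>x. \<bar>B - B'\<bar> + r * \<bar>u - v\<bar> * W x \<partial>P)"
  proof (rule integral_mono_AE)
    show "AE x in P. \<bar>tanh (B + r * u * W x) - tanh (B' + r * v * W x)\<bar> \<le> \<bar>B - B'\<bar> + r * \<bar>u - v\<bar> * W x"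
      using W_nonneg
    proof eventually_elim
      case (elim x)
      have "\<bar>tanh (B + r * u * W x) - tanh (B' + r * v * W x)\<bar> \<le> \<bar>(B - B') + (r * (u - v) * W x)\<bar>"
        using tanh_Lipschitz[of "B + r * u * W x" "B' + r * v * W x"] by (simp add: algebra_simps)
      also have "\<dots> \<le> \<bar>B - B'\<bar> + \<bar>r * (u - v) * W x\<bar>" by (rule abs_triangle_ineq)
      finally show ?case using elim r_nonneg by (simp add: abs_mult)
    qed
  qed (auto intro!: integrable_abs Bochner_Integration.integrable_diff)
  finally show ?thesis by (simp add: prob_space)
qed

text \<open>
  Convexity in the field, inherited from \<open>ln cosh\<close>. It controls how the free energy varies with \<open>B\<close> and makes the
  magnetization monotone.
\<close>

lemma free_energy_subgradient:
  "free_energy B v + (B' - B) * magnetization B v \<le> free_energy B' v"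
proof -
  have "(\<integral>x. ln (cosh (B + r * v * W x)) + (B' - B) * tanh (B + r * v * W x) \<partial>P)
      \<le> (\<integral>x. ln (cosh (B' + r * v * W x)) \<partial>P)"
  proof (rule integral_mono)
    fix x
    show "ln (cosh (B + r * v * W x)) + (B' - B) * tanh (B + r * v * W x) \<le> ln (cosh (B' + r * v * W x))"
      using ln_cosh_tangent[of "B + r * v * W x" "B' + r * v * W x"] by simp
  qed auto
  then show ?thesis
    unfolding free_energy_def magnetization_def by simp
qed

lemma free_energy_Lipschitz_field: "free_energy B' v \<le> free_energy B v + \<bar>B' - B\<bar>"
proof -
  have "free_energy B' v - free_energy B v \<le> (B' - B) * magnetization B' v"
    using free_energy_subgradient[of B' v B] by (simp add: algebra_simps)
  also have "\<dots> \<le> \<bar>B' - B\<bar> * \<bar>magnetization B' v\<bar>" by (simp flip: abs_mult)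
  also have "\<dots> \<le> \<bar>B' - B\<bar> * 1" by (intro mult_left_mono magnetization_bound) auto
  finally show ?thesis by simp
qed

lemma free_energy_upper: "free_energy B v \<le> \<bar>B\<bar> + r * \<bar>v\<bar> * (\<integral>x. W x \<partial>P) - v\<^sup>2 / 2"
proof -
  have "(\<integral>x. ln (cosh (B + r * v * W x)) \<partial>P) \<le> (\<integral>x. \<bar>B\<bar> + r * \<bar>v\<bar> * W x \<partial>P)"
  proof (rule integral_mono_AE)
    show "AE x in P. ln (cosh (B + r * v * W x)) \<le> \<bar>B\<bar> + r * \<bar>v\<bar> * W x"
      using W_nonneg
    proof eventually_elim
      case (elim x)
      have "\<bar>B + r * v * W x\<bar> \<le> \<bar>B\<bar> + \<bar>r * v * W x\<bar>" by (rule abs_triangle_ineq)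
      with elim r_nonneg ln_cosh_le_abs[of "B + r * v * W x"] show ?case by (simp add: abs_mult)
    qed
  qed auto
  then show ?thesis unfolding free_energy_def by (simp add: prob_space)
qed

text \<open>
  The second-order remainder of \<open>ln cosh\<close> is at most the squared increment, uniformly in the base point; finiteness
  of the second moment of \<open>W\<close> therefore justifies differentiating under the expectation.
\<close>

lemma free_energy_has_derivative:
  "((\<lambda>u. free_energy B u) has_real_derivative (mean_field B u - u)) (at u)"
proof -
  define c where "c = r\<^sup>2 * (\<integral>x. (W x)\<^sup>2 \<partial>P)"
  define h where "h = (\<lambda>u. \<integral>x. ln (cosh (B + r * u * W x)) \<partial>P)"
  have bound: "\<bar>h v - h u - (v - u) * mean_field B u\<bar> \<le> (v - u)\<^sup>2 * c" for v
  proof -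
    let ?D = "\<lambda>x. ln (cosh (B + r * v * W x)) - ln (cosh (B + r * u * W x))
        - (v - u) * r * (W x * tanh (B + r * u * W x))"
    have "h v - h u - (v - u) * mean_field B u = (\<integral>x. ?D x \<partial>P)"
    proof -
      have "(\<integral>x. (v - u) * r * (W x * tanh (B + r * u * W x)) \<partial>P) = (v - u) * mean_field B u"
        unfolding mean_field_def by (simp only: integral_mult_right_zero mult.assoc)
      moreover have "(\<integral>x. ?D x \<partial>P) = h v - h u
          - (\<integral>x. (v - u) * r * (W x * tanh (B + r * u * W x)) \<partial>P)"
        unfolding h_def
        by (simp only: Bochner_Integration.integral_diff Bochner_Integration.integrable_diff
              integrable_mult_right W_tanh_int ln_cosh_int)
      ultimately show ?thesis by (simp only:)
    qed
    moreover have "\<bar>\<integral>x. ?D x \<partial>P\<bar> \<le> (\<integral>x. \<bar>?D x\<bar> \<partial>P)"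
      using integral_norm_bound[of P ?D] by simp
    moreover have "(\<integral>x. \<bar>?D x\<bar> \<partial>P) \<le> (\<integral>x. (v - u)\<^sup>2 * r\<^sup>2 * (W x)\<^sup>2 \<partial>P)"
    proof (rule integral_mono)
      show "\<bar>?D x\<bar> \<le> (v - u)\<^sup>2 * r\<^sup>2 * (W x)\<^sup>2" for x
      proof -
        have step: "(B + r * v * W x) - (B + r * u * W x) = (v - u) * r * W x"
          by (simp add: algebra_simps)
        show ?thesis
          using ln_cosh_Taylor[of "B + r * v * W x" "B + r * u * W x"]
          unfolding step by (simp only: power_mult_distrib mult.assoc)
      qed
    qed (intro integrable_abs Bochner_Integration.integrable_diff integrable_mult_right
          W_tanh_int ln_cosh_int W2_int)+
    moreover have "(\<integral>x. (v - u)\<^sup>2 * r\<^sup>2 * (W x)\<^sup>2 \<partial>P) = (v - u)\<^sup>2 * c"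
      by (simp add: c_def mult.assoc)
    ultimately show ?thesis by (simp only:)
  qed
  have "((\<lambda>v. (h v - h u) / (v - u) - mean_field B u) \<longlongrightarrow> 0) (at u)"
  proof (rule Lim_null_comparison)
    show "\<forall>\<^sub>F v in at u. norm ((h v - h u) / (v - u) - mean_field B u) \<le> \<bar>v - u\<bar> * c"
      unfolding eventually_at_filter
    proof (intro always_eventually allI impI)
      fix v assume ne: "v \<noteq> u"
      have "(h v - h u) / (v - u) - mean_field B u = (h v - h u - (v - u) * mean_field B u) / (v - u)"
        using ne by (simp add: field_simps)
      then have "norm ((h v - h u) / (v - u) - mean_field B u) = \<bar>h v - h u - (v - u) * mean_field B u\<bar> / \<bar>v - u\<bar>"
        by (simp add: abs_divide)
      also have "\<dots> \<le> (v - u)\<^sup>2 * c / \<bar>v - u\<bar>" by (intro divide_right_mono bound) auto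
      also have "(v - u)\<^sup>2 = \<bar>v - u\<bar> * \<bar>v - u\<bar>" by (simp add: power2_eq_square)
      also have "\<bar>v - u\<bar> * \<bar>v - u\<bar> * c / \<bar>v - u\<bar> = \<bar>v - u\<bar> * c" using ne by (simp del: abs_mult_self_eq)
      finally show "norm ((h v - h u) / (v - u) - mean_field B u) \<le> \<bar>v - u\<bar> * c" .
    qed
    show "((\<lambda>v. \<bar>v - u\<bar> * c) \<longlongrightarrow> 0) (at u)"
      by (auto intro!: tendsto_eq_intros)
  qed
  then have "(h has_real_derivative mean_field B u) (at u)"
    unfolding has_field_derivative_iff using LIM_zero_iff by blast
  then have "((\<lambda>u. h u - u\<^sup>2 / 2) has_real_derivative (mean_field B u - u)) (at u)"
    by (auto intro!: derivative_eq_intros)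
  then show ?thesis unfolding free_energy_def h_def .
qed

lemma maximizer_fixed_point:
  assumes "maximizer B u" shows "mean_field B u = u"
proof -
  have "mean_field B u - u = 0"
    by (rule DERIV_local_max[OF free_energy_has_derivative, of 1])
       (use assms in \<open>auto simp: maximizer_def\<close>)
  then show ?thesis by simp
qed

lemma free_energy_continuous: "continuous_on S (free_energy B)"
  by (meson DERIV_isCont continuous_at_imp_continuous_on free_energy_has_derivative)

text \<open>
  The quadratic penalty beats the at most linear growth of the \<open>ln cosh\<close> term, so that compactness arguments
  apply although \<open>u\<close> ranges over the whole line.
\<close>

lemma free_energy_below_outside:
  obtains C where "0 < C" "\<And>v. C < \<bar>v\<bar> \<Longrightarrow> free_energy B v < K"
proof -
  define m where "m = (\<integral>x. W x \<partial>P)"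
  define C where "C = 2 * (r * m + \<bar>B\<bar> + \<bar>K\<bar> + 1)"
  have m0: "0 \<le> r * m" using r_nonneg W_mean_pos by (simp add: m_def)
  show thesis
  proof
    show "0 < C" using m0 by (simp add: C_def)
    fix v assume v: "C < \<bar>v\<bar>"
    then have v1: "1 \<le> \<bar>v\<bar>" using m0 by (simp add: C_def)
    have "\<bar>v\<bar> * (2 * (r * m + \<bar>B\<bar> + \<bar>K\<bar> + 1)) \<le> \<bar>v\<bar> * \<bar>v\<bar>"
      using v by (intro mult_left_mono) (auto simp: C_def)
    then have *: "r * \<bar>v\<bar> * m + \<bar>v\<bar> * (\<bar>B\<bar> + \<bar>K\<bar> + 1) \<le> v\<^sup>2 / 2"
      by (simp add: power2_eq_square algebra_simps)
    define A where "A = \<bar>B\<bar> + \<bar>K\<bar> + 1"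
    have "1 * (\<bar>B\<bar> + \<bar>K\<bar> + 1) \<le> \<bar>v\<bar> * (\<bar>B\<bar> + \<bar>K\<bar> + 1)"
      using v1 by (intro mult_right_mono) auto
    from order_trans[OF add_left_mono[OF this] *]
    have "r * \<bar>v\<bar> * m + A \<le> v\<^sup>2 / 2" unfolding A_def by simp
    then have "\<bar>B\<bar> + r * \<bar>v\<bar> * m - v\<^sup>2 / 2 < K"
      using abs_ge_minus_self[of K] unfolding A_def by linarith
    with free_energy_upper[of B v] show "free_energy B v < K" by (simp add: m_def)
  qed
qed

lemma maximizer_exists: "\<exists>u. maximizer B u"
proof -
  obtain C where C: "0 < C" "\<And>v. C < \<bar>v\<bar> \<Longrightarrow> free_energy B v < free_energy B 0"
    using free_energy_below_outside by blast
  obtain u where u: "u \<in> {-C..C}" "\<forall>v\<in>{-C..C}. free_energy B v \<le> free_energy B u"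
    using continuous_attains_sup[of "{-C..C}" "free_energy B"] free_energy_continuous C by auto
  have "free_energy B v \<le> free_energy B u" for v
  proof (cases "v \<in> {-C..C}")
    case False
    then have "C < \<bar>v\<bar>" by auto
    with C(2)[of v] have "free_energy B v < free_energy B 0" by simp
    also have "\<dots> \<le> free_energy B u" using u C by auto
    finally show ?thesis by simp
  qed (use u in auto)
  then show ?thesis by (auto simp: maximizer_def)
qed

lemma unique_maximizer_gap:
  assumes u: "unique_maximizer B u" and \<delta>: "0 < \<delta>"
  obtains \<kappa> where "0 < \<kappa>" "\<And>v. \<delta> \<le> \<bar>v - u\<bar> \<Longrightarrow> free_energy B v \<le> free_energy B u - \<kappa>"
proof -
  obtain C where C: "0 < C" "\<And>v. C < \<bar>v\<bar> \<Longrightarrow> free_energy B v < free_energy B u - 1"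
    using free_energy_below_outside by blast
  define S where "S = {-C..C} \<inter> ({u + \<delta>..} \<union> {..u - \<delta>})"
  have comp: "compact S" unfolding S_def by (intro compact_Int_closed) auto
  obtain \<kappa> where \<kappa>: "0 < \<kappa>" "\<And>v. v \<in> S \<Longrightarrow> free_energy B v \<le> free_energy B u - \<kappa>"
  proof (cases "S = {}")
    case True
    then show thesis using that[of 1] by simp
  next
    case False
    obtain s where s: "s \<in> S" "\<forall>v\<in>S. free_energy B v \<le> free_energy B s"
      using continuous_attains_sup[OF comp False free_energy_continuous] by blast
    have "s \<noteq> u" using s \<delta> by (auto simp: S_def)
    with u obtain v where "free_energy B s < free_energy B v"
      unfolding unique_maximizer_def maximizer_def by (meson not_le)
    also have "\<dots> \<le> free_energy B u" using u unfolding unique_maximizer_def maximizer_def by blast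
    finally show thesis using s by (intro that[of "free_energy B u - free_energy B s"]) auto
  qed
  show thesis
  proof
    show "0 < min \<kappa> 1" using \<kappa> by simp
    fix v assume v: "\<delta> \<le> \<bar>v - u\<bar>"
    show "free_energy B v \<le> free_energy B u - min \<kappa> 1"
    proof (cases "C < \<bar>v\<bar>")
      case True then show ?thesis using C(2)[of v] by simp
    next
      case False
      then have "v \<in> S" using v by (auto simp: S_def)
      then show ?thesis using \<kappa>(2)[of v] by simp
    qed
  qed
qed

text \<open>
  Envelope principle: at a unique maximizer the maximal free energy has derivative \<open>magnetization B u\<close> in the
  field. An upper bound on its increments is what an exponential Chebyshev argument consumes. Values \<open>v\<close> near \<open>u\<close>
  are handled by convexity in the field and continuity of the magnetization, the others by the gap.
\<close>

lemma envelope_upper_bound: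
  assumes u: "unique_maximizer B u" and \<eta>: "0 < \<eta>"
  obtains \<tau> where "0 < \<tau>"
    "\<And>t v. \<bar>t\<bar> \<le> \<tau> \<Longrightarrow> free_energy (B + t) v \<le> free_energy B u + t * magnetization B u + \<bar>t\<bar> * \<eta>"
proof -
  define m where "m = (\<integral>x. W x \<partial>P)"
  define \<delta> where "\<delta> = \<eta> / (2 * (r * m + 1))"
  have m0: "0 \<le> r * m" using r_nonneg W_mean_pos by (simp add: m_def)
  have \<delta>: "0 < \<delta>" using m0 \<eta> by (simp add: \<delta>_def)
  have "\<delta> * (2 * (r * m + 1)) = \<eta>" using m0 by (simp add: \<delta>_def)
  then have r\<delta>: "r * \<delta> * m \<le> \<eta> / 2" using \<delta> by (simp add: algebra_simps)
  obtain \<kappa> where \<kappa>: "0 < \<kappa>" "\<And>v. \<delta> \<le> \<bar>v - u\<bar> \<Longrightarrow> free_energy B v \<le> free_energy B u - \<kappa>"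
    using unique_maximizer_gap[OF u \<delta>] by blast
  show thesis
  proof
    show "0 < min (\<eta> / 2) (\<kappa> / 2)" using \<eta> \<kappa> by simp
    fix t v :: real assume t: "\<bar>t\<bar> \<le> min (\<eta> / 2) (\<kappa> / 2)"
    show "free_energy (B + t) v \<le> free_energy B u + t * magnetization B u + \<bar>t\<bar> * \<eta>"
    proof (cases "\<delta> \<le> \<bar>v - u\<bar>")
      case True
      \<comment> \<open>far from the maximizer the gap \<open>\<kappa>\<close> outweighs any effect of a small change of field\<close>
      have "free_energy (B + t) v \<le> free_energy B v + \<bar>t\<bar>"
        using free_energy_Lipschitz_field[of "B + t" v B] by simp
      also have "\<dots> \<le> free_energy B u - \<bar>t\<bar>" using \<kappa>(2)[OF True] t by simp
      also have "- \<bar>t\<bar> \<le> t * magnetization B u"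
      proof -
        have "\<bar>t\<bar> * \<bar>magnetization B u\<bar> \<le> \<bar>t\<bar> * 1"
          by (intro mult_left_mono magnetization_bound) auto
        then show ?thesis by (simp flip: abs_mult)
      qed
      then have "free_energy B u - \<bar>t\<bar> \<le> free_energy B u + t * magnetization B u + \<bar>t\<bar> * \<eta>"
        using mult_nonneg_nonneg[of "\<bar>t\<bar>" \<eta>] \<eta> by linarith
      finally show ?thesis .
    next
      case False
      have "\<bar>magnetization (B + t) v - magnetization B u\<bar> \<le> \<bar>t\<bar> + r * \<bar>v - u\<bar> * m"
        using magnetization_Lipschitz[of "B + t" v B u] by (simp add: m_def)
      also have "r * \<bar>v - u\<bar> * m \<le> r * \<delta> * m"
        using False r_nonneg W_mean_pos by (intro mult_right_mono mult_left_mono) (auto simp: m_def)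
      finally have diff: "\<bar>magnetization (B + t) v - magnetization B u\<bar> \<le> \<eta>" using t r\<delta> by simp
      have "free_energy (B + t) v \<le> free_energy B v + t * magnetization (B + t) v"
        using free_energy_subgradient[of "B + t" v B] by simp
      also have "free_energy B v \<le> free_energy B u"
        using u by (simp add: unique_maximizer_def maximizer_def)
      also have "t * magnetization (B + t) v
          = t * magnetization B u + t * (magnetization (B + t) v - magnetization B u)"
        by (simp add: algebra_simps)
      also have "t * (magnetization (B + t) v - magnetization B u)
          \<le> \<bar>t\<bar> * \<bar>magnetization (B + t) v - magnetization B u\<bar>" by (simp flip: abs_mult)
      also have "\<dots> \<le> \<bar>t\<bar> * \<eta>" using diff by (intro mult_left_mono) auto
      finally show ?thesis by simp
    qed
  qed
qed


section \<open>Uniqueness of the maximizer\<close>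

lemma free_energy_uminus: "free_energy (- B) (- u) = free_energy B u"
proof -
  have "cosh (- B + r * - u * W x) = cosh (B + r * u * W x)" for x
  proof -
    have "- B + r * - u * W x = - (B + r * u * W x)" by simp
    then show ?thesis by (simp only: cosh_minus)
  qed
  then show ?thesis unfolding free_energy_def by (simp only: power2_minus)
qed

lemma unique_maximizer_uminus:
  assumes "unique_maximizer B u" shows "unique_maximizer (- B) (- u)"
proof -
  have "free_energy (- B) v = free_energy B (- v)" for v
    using free_energy_uminus[of B "- v"] by simp
  with assms show ?thesis
    unfolding unique_maximizer_def maximizer_def by (metis minus_minus)
qed

text \<open>
  For \<open>B > 0\<close> a negative \<open>u\<close> loses against its mirror image, because \<open>cosh\<close> grows with the modulus and
  \<open>\<bar>B - x\<bar> < B + x\<close>.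
\<close>

lemma free_energy_reflect_less:
  assumes B: "0 < B" and r: "0 < r" and u: "u < 0"
  shows "free_energy B u < free_energy B (- u)"
proof -
  have less: "ln (cosh (B + r * u * y)) < ln (cosh (B + r * (- u) * y))" if y: "0 < y" for y
  proof -
    have "0 < r * (- u) * y" using r u y by (intro mult_pos_pos) auto
    then have "\<bar>B + r * u * y\<bar> < \<bar>B + r * (- u) * y\<bar>" using B by auto
    then have "cosh \<bar>B + r * u * y\<bar> < cosh \<bar>B + r * (- u) * y\<bar>"
      by (intro cosh_real_strict_mono) auto
    then show ?thesis by (simp add: cosh_real_pos)
  qed
  have "0 < (\<integral>x. ln (cosh (B + r * (- u) * W x)) - ln (cosh (B + r * u * W x)) \<partial>P)"
  proof (rule integral_pos_weight)
    show "AE x in P. 0 \<le> ln (cosh (B + r * (- u) * W x)) - ln (cosh (B + r * u * W x))"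
      using W_nonneg
    proof eventually_elim
      case (elim x) then show ?case using less[of "W x"] by (cases "W x = 0") auto
    qed
    show "integrable P (\<lambda>x. ln (cosh (B + r * (- u) * W x)) - ln (cosh (B + r * u * W x)))"
      by (intro Bochner_Integration.integrable_diff ln_cosh_int)
  qed (use less in auto)
  also have "\<dots> = (\<integral>x. ln (cosh (B + r * (- u) * W x)) \<partial>P) - (\<integral>x. ln (cosh (B + r * u * W x)) \<partial>P)"
    by (intro Bochner_Integration.integral_diff ln_cosh_int)
  finally show ?thesis unfolding free_energy_def by simp
qed

lemma mean_field_over_argument_decreasing:
  assumes B: "0 \<le> B" and r: "0 < r" and uv: "0 < u" "u < v"
  shows "mean_field B v / v < mean_field B u / u"
proof -
  have less: "tanh (B + r * v * y) / v * y < tanh (B + r * u * y) / u * y" if y: "0 < y" for y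
  proof -
    have "tanh (B + r * v * y) / (r * v * y) < tanh (B + r * u * y) / (r * u * y)"
      using B r uv y by (intro tanh_over_argument_decreasing) auto
    then have "tanh (B + r * v * y) / (r * v * y) * (r * y * y) < tanh (B + r * u * y) / (r * u * y) * (r * y * y)"
      using r y by (intro mult_strict_right_mono mult_pos_pos)
    then show ?thesis using r y uv by (simp add: field_simps)
  qed
  have "0 < (\<integral>x. (1 / u) * (W x * tanh (B + r * u * W x)) - (1 / v) * (W x * tanh (B + r * v * W x)) \<partial>P)"
  proof (rule integral_pos_weight)
    show "AE x in P. 0 \<le> (1 / u) * (W x * tanh (B + r * u * W x)) - (1 / v) * (W x * tanh (B + r * v * W x))"
      using W_nonneg
    proof eventually_elim
      case (elim x) then show ?case using less[of "W x"] by (cases "W x = 0") (auto simp: mult.commute)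
    qed
    show "integrable P (\<lambda>x. (1 / u) * (W x * tanh (B + r * u * W x)) - (1 / v) * (W x * tanh (B + r * v * W x)))"
      by (intro Bochner_Integration.integrable_diff integrable_mult_right W_tanh_int)
    show "0 < (1 / u) * (W x * tanh (B + r * u * W x)) - (1 / v) * (W x * tanh (B + r * v * W x))"
      if "0 < W x" for x
      using less[OF that] by (simp add: mult.commute)
  qed
  also have "\<dots> = (1 / u) * (\<integral>x. W x * tanh (B + r * u * W x) \<partial>P) - (1 / v) * (\<integral>x. W x * tanh (B + r * v * W x) \<partial>P)"
    by simp
  finally have "(1 / v) * (\<integral>x. W x * tanh (B + r * v * W x) \<partial>P) < (1 / u) * (\<integral>x. W x * tanh (B + r * u * W x) \<partial>P)"
    by simp
  from mult_strict_left_mono[OF this r] show ?thesis by (simp add: mean_field_def)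
qed

lemma maximizer_nonneg:
  assumes B: "0 < B" and max: "maximizer B u"
  shows "0 \<le> u" "0 < r \<Longrightarrow> 0 < u"
proof -
  have fix_u: "mean_field B u = u" by (rule maximizer_fixed_point[OF max])
  have pos: "0 < u" if r: "0 < r"
  proof (rule ccontr)
    assume "\<not> 0 < u"
    then consider "u < 0" | "u = 0" by linarith
    then show False
    proof cases
      case 1
      then show False using free_energy_reflect_less[OF B r 1] max
        unfolding maximizer_def by (meson not_le)
    next
      case 2
      then have "u = r * ((\<integral>x. W x \<partial>P) * tanh B)" using fix_u by (simp add: mean_field_def)
      also have "\<dots> > 0" using r W_mean_pos B by simp
      finally show False using 2 by simp
    qed
  qed
  then show "0 < r \<Longrightarrow> 0 < u" .
  show "0 \<le> u"
  proof (cases "r = 0")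
    case True then show ?thesis using fix_u unfolding mean_field_def by simp
  next
    case False then show ?thesis using pos r_nonneg by simp
  qed
qed

text \<open>
  A positive maximizer \<open>u\<close> is a fixed point of \<open>mean_field B\<close>, i.e. \<open>mean_field B u / u = 1\<close>, and this ratio is
  strictly decreasing, so it equals 1 at most once.
\<close>

lemma unique_maximizer_pos_field:
  assumes B: "0 < B" shows "\<exists>u. unique_maximizer B u"
proof -
  have no_two: False if "maximizer B u" "maximizer B v" "u < v" for u v
  proof (cases "r = 0")
    case True
    have "mean_field B u = u" "mean_field B v = v" using that maximizer_fixed_point by auto
    with True \<open>u < v\<close> show False unfolding mean_field_def by simp
  next
    case False
    then have r: "0 < r" using r_nonneg by simp
    have u: "0 < u" using maximizer_nonneg(2)[OF B that(1) r] .
    have "mean_field B v / v < mean_field B u / u"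
      using B r u that by (intro mean_field_over_argument_decreasing) auto
    then show False using u that maximizer_fixed_point[of B u] maximizer_fixed_point[of B v] by simp
  qed
  obtain u where u: "maximizer B u" using maximizer_exists by blast
  have "v = u" if "maximizer B v" for v
    using no_two[OF u that] no_two[OF that u] by (meson linorder_neqE)
  with u show ?thesis by (auto simp: unique_maximizer_def)
qed

lemma unique_maximizer_nonzero_field:
  assumes "B \<noteq> 0" shows "\<exists>u. unique_maximizer B u"
proof (cases "0 < B")
  case False
  then obtain u where "unique_maximizer (- B) u" using unique_maximizer_pos_field[of "- B"] assms by auto
  from unique_maximizer_uminus[OF this] show ?thesis by auto
qed (rule unique_maximizer_pos_field)

text \<open>
  Since \<open>\<bar>tanh x\<bar> \<le> \<bar>x\<bar>\<close>, the map \<open>mean_field 0\<close> shrinks every nonzero argument by the factor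
  \<open>r\<^sup>2 E W\<^sup>2 < 1\<close>, so 0 is its only fixed point.
\<close>

lemma unique_maximizer_subcritical:
  assumes sub: "r\<^sup>2 * (\<integral>x. (W x)\<^sup>2 \<partial>P) < 1" shows "unique_maximizer 0 0"
proof -
  have zero: "u = 0" if max: "maximizer 0 u" for u
  proof (rule ccontr)
    assume ne: "u \<noteq> 0"
    have "\<bar>u\<bar> = \<bar>mean_field 0 u\<bar>" using maximizer_fixed_point[OF max] by simp
    also have "\<dots> = r * \<bar>\<integral>x. W x * tanh (0 + r * u * W x) \<partial>P\<bar>"
      using r_nonneg by (simp add: mean_field_def abs_mult)
    also have "\<dots> \<le> r * (\<integral>x. \<bar>W x * tanh (0 + r * u * W x)\<bar> \<partial>P)"
      using integral_norm_bound[of P "\<lambda>x. W x * tanh (0 + r * u * W x)"] r_nonneg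
      by (intro mult_left_mono) auto
    also have "\<dots> \<le> r * (\<integral>x. r * \<bar>u\<bar> * (W x)\<^sup>2 \<partial>P)"
    proof (intro mult_left_mono[OF _ r_nonneg] integral_mono)
      fix x
      have "\<bar>W x * tanh (0 + r * u * W x)\<bar> \<le> \<bar>W x\<bar> * \<bar>r * u * W x\<bar>"
        using tanh_Lipschitz[of "r * u * W x" 0] by (simp add: abs_mult mult_left_mono)
      also have "\<dots> = r * \<bar>u\<bar> * (\<bar>W x\<bar> * \<bar>W x\<bar>)"
        using r_nonneg by (simp add: abs_mult del: abs_mult_self_eq)
      also have "\<dots> = r * \<bar>u\<bar> * (W x)\<^sup>2" by (simp add: power2_eq_square)
      finally show "\<bar>W x * tanh (0 + r * u * W x)\<bar> \<le> r * \<bar>u\<bar> * (W x)\<^sup>2" .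
    qed (intro integrable_abs W_tanh_int, simp)
    also have "\<dots> = \<bar>u\<bar> * (r\<^sup>2 * (\<integral>x. (W x)\<^sup>2 \<partial>P))" by (simp add: power2_eq_square)
    also have "\<dots> < \<bar>u\<bar> * 1" using sub ne by (intro mult_strict_left_mono) auto
    finally show False by simp
  qed
  obtain u where "maximizer 0 u" using maximizer_exists by blast
  with zero show ?thesis unfolding unique_maximizer_def by metis
qed

section \<open>Spontaneous magnetization above criticality\<close>

text \<open>
  The magnetizations at maximizers are subgradients of the convex function \<open>max\<^sub>u free_energy B u\<close> of \<open>B\<close>.
\<close>

lemma magnetization_mono_field:
  assumes "maximizer B u" "maximizer B' u'" and "B < B'"
  shows "magnetization B u \<le> magnetization B' u'"
proof -
  have lt: "0 < B' - B" using assms by simp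
  have "free_energy B u + (B' - B) * magnetization B u \<le> free_energy B' u'"
    using free_energy_subgradient[of B u B'] assms by (meson maximizer_def order_trans)
  moreover have "free_energy B' u' - (B' - B) * magnetization B' u' \<le> free_energy B u"
    using free_energy_subgradient[of B' u' B] assms(1) unfolding maximizer_def
    by (smt (verit) minus_diff_eq mult_minus_left)
  ultimately have "(B' - B) * magnetization B u \<le> (B' - B) * magnetization B' u'" by linarith
  with lt show ?thesis by simp
qed

text \<open>
  The ratio \<open>mean_field 0 u / u\<close> tends to \<open>r\<^sup>2 E W\<^sup>2 > 1\<close> as \<open>u \<rightarrow> 0\<close>, by dominated convergence.
\<close>

lemma supercritical_mean_field_exceeds:
  assumes super: "1 < r\<^sup>2 * (\<integral>x. (W x)\<^sup>2 \<partial>P)"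
  obtains \<delta> where "0 < \<delta>" "\<delta> < mean_field 0 \<delta>"
proof -
  have r: "0 < r" using super r_nonneg by (cases "r = 0") auto
  let ?u = "\<lambda>n. 1 / real (Suc n)"
  have "(\<lambda>n. \<integral>x. W x * tanh (0 + r * ?u n * W x) / ?u n \<partial>P) \<longlonglongrightarrow> (\<integral>x. r * (W x)\<^sup>2 \<partial>P)"
  proof (rule integral_dominated_convergence[where w = "\<lambda>x. r * (W x)\<^sup>2"])
    show "AE x in P. (\<lambda>n. W x * tanh (0 + r * ?u n * W x) / ?u n) \<longlonglongrightarrow> r * (W x)\<^sup>2"
    proof (rule AE_I2)
      fix x
      have "((\<lambda>u. tanh (r * u * W x)) has_real_derivative r * W x) (at 0)"
        by (auto intro!: derivative_eq_intros)
      then have "((\<lambda>u. tanh (r * u * W x) / u) \<longlongrightarrow> r * W x) (at 0)"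
        by (simp add: has_field_derivative_iff)
      moreover have "filterlim ?u (at 0) sequentially"
        unfolding filterlim_at using LIMSEQ_inverse_real_of_nat by (auto simp: field_simps)
      ultimately have "(\<lambda>n. tanh (r * ?u n * W x) / ?u n) \<longlonglongrightarrow> r * W x"
        by (rule filterlim_compose)
      from tendsto_mult[OF tendsto_const[of "W x"] this]
      show "(\<lambda>n. W x * tanh (0 + r * ?u n * W x) / ?u n) \<longlonglongrightarrow> r * (W x)\<^sup>2"
        by (simp add: power2_eq_square algebra_simps)
    qed
    show "AE x in P. norm (W x * tanh (0 + r * ?u n * W x) / ?u n) \<le> r * (W x)\<^sup>2" for n
    proof (rule AE_I2)
      fix x
      have u: "0 < ?u n" by simp
      have "\<bar>W x\<bar> * \<bar>tanh (r * ?u n * W x)\<bar> \<le> \<bar>W x\<bar> * \<bar>r * ?u n * W x\<bar>"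
        using tanh_Lipschitz[of "r * ?u n * W x" 0] by (intro mult_left_mono) auto
      also have "\<dots> = r * ?u n * (\<bar>W x\<bar> * \<bar>W x\<bar>)"
        using r u by (simp add: abs_mult del: abs_mult_self_eq)
      also have "\<dots> = r * (W x)\<^sup>2 * ?u n" by (simp add: power2_eq_square)
      finally have "\<bar>W x\<bar> * \<bar>tanh (r * ?u n * W x)\<bar> / ?u n \<le> r * (W x)\<^sup>2"
        using u by (subst pos_divide_le_eq) auto
      then show "norm (W x * tanh (0 + r * ?u n * W x) / ?u n) \<le> r * (W x)\<^sup>2"
        by (simp add: abs_mult)
    qed
  qed auto
  then have "(\<lambda>n. r * (\<integral>x. W x * tanh (0 + r * ?u n * W x) / ?u n \<partial>P)) \<longlonglongrightarrow> r * (r * (\<integral>x. (W x)\<^sup>2 \<partial>P))"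
    by (intro tendsto_mult) auto
  moreover have "1 < r * (r * (\<integral>x. (W x)\<^sup>2 \<partial>P))" using super by (simp add: power2_eq_square)
  ultimately have "\<forall>\<^sub>F n in sequentially. 1 < r * (\<integral>x. W x * tanh (0 + r * ?u n * W x) / ?u n \<partial>P)"
    by (rule order_tendstoD)
  then obtain n where n: "1 < r * (\<integral>x. W x * tanh (0 + r * ?u n * W x) / ?u n \<partial>P)"
    by (auto simp: eventually_sequentially)
  have "r * (\<integral>x. W x * tanh (0 + r * ?u n * W x) / ?u n \<partial>P) = mean_field 0 (?u n) / ?u n"
    unfolding mean_field_def by (subst integral_divide_zero) simp
  with n have "?u n < mean_field 0 (?u n)" by (simp add: field_simps)
  then show thesis by (intro that[of "?u n"]) auto
qed

text \<open>
  Below the point \<open>\<delta>\<close> where \<open>mean_field 0\<close> exceeds the identity, \<open>mean_field 0\<close> still does, by monotonicity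
  of the ratio, and \<open>mean_field B\<close> is larger still. Hence no maximizer for \<open>B > 0\<close> lies in \<open>(0, \<delta>)\<close>, and the bound is uniform in \<open>B\<close>.
\<close>

lemma magnetization_bounded_below:
  assumes super: "1 < r\<^sup>2 * (\<integral>x. (W x)\<^sup>2 \<partial>P)"
  obtains m where "0 < m" "\<And>B u. 0 < B \<Longrightarrow> maximizer B u \<Longrightarrow> m \<le> magnetization B u"
proof -
  have r: "0 < r" using super r_nonneg by (cases "r = 0") auto
  obtain \<delta> where \<delta>: "0 < \<delta>" "\<delta> < mean_field 0 \<delta>" using supercritical_mean_field_exceeds[OF super] .
  have mono: "tanh (B + r * u * y) \<ge> tanh (r * u' * y)" if "0 \<le> B" "u' \<le> u" "0 \<le> y" for B u u' y
  proof -
    have "r * u' * y \<le> r * u * y" using r that by (intro mult_right_mono mult_left_mono) auto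
    with that show ?thesis by simp
  qed
  show thesis
  proof
    show "0 < magnetization 0 \<delta>"
      unfolding magnetization_def
    proof (rule integral_pos_weight)
      show "AE x in P. 0 \<le> tanh (0 + r * \<delta> * W x)"
        using W_nonneg by eventually_elim (use r \<delta> in auto)
      show "integrable P (\<lambda>x. tanh (0 + r * \<delta> * W x))" by (rule tanh_int)
    qed (use r \<delta> in auto)
    fix B u assume B: "0 < B" and max: "maximizer B u"
    have u: "0 < u" using maximizer_nonneg(2)[OF B max r] .
    have "\<delta> \<le> u"
    proof (rule ccontr)
      assume "\<not> \<delta> \<le> u"
      then have "mean_field 0 \<delta> / \<delta> < mean_field 0 u / u"
        using r u by (intro mean_field_over_argument_decreasing) auto
      moreover have "1 < mean_field 0 \<delta> / \<delta>" using \<delta> by simp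
      ultimately have "1 < mean_field 0 u / u" by linarith
      then have "u < mean_field 0 u" using u by (simp add: less_divide_eq)
      also have "\<dots> \<le> mean_field B u"
        unfolding mean_field_def
      proof (intro mult_left_mono[OF _ r_nonneg] integral_mono_AE W_tanh_int)
        show "AE x in P. W x * tanh (0 + r * u * W x) \<le> W x * tanh (B + r * u * W x)"
          using W_nonneg
        proof eventually_elim
          case (elim x) then show ?case using mono[of B u u "W x"] B by (auto intro!: mult_left_mono)
        qed
      qed
      finally show False using maximizer_fixed_point[OF max] by simp
    qed
    then show "magnetization 0 \<delta> \<le> magnetization B u"
      unfolding magnetization_def
    proof (intro integral_mono_AE tanh_int)
      show "AE x in P. tanh (0 + r * \<delta> * W x) \<le> tanh (B + r * u * W x)"
        using W_nonneg
      proof eventually_elim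
        case (elim x) then show ?case using mono[of B \<delta> u "W x"] B \<open>\<delta> \<le> u\<close> by simp
      qed
    qed
  qed
qed

end

section \<open>Comparison with an inhomogeneous Curie-Weiss model\<close>

definition edge_intensity :: "(nat \<Rightarrow> nat \<Rightarrow> real) \<Rightarrow> nat \<Rightarrow> nat \<Rightarrow> nat \<Rightarrow> real" where
  "edge_intensity w N i j = w N i * w N j / total_weight w N"

text \<open>
  An upper bound, up to a constant, for the total cost of replacing \<open>ln (1 + q x)\<close> by \<open>q x\<close> on all edges. The factor
  \<open>min 1 q\<close> in place of \<open>q\<close> lets a first-moment truncation show that the sum is of order smaller than \<open>N\<close>.
\<close>

definition intensity_error :: "(nat \<Rightarrow> nat \<Rightarrow> real) \<Rightarrow> nat \<Rightarrow> real" where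
  "intensity_error w N =
     (\<Sum>i\<in>{1..N}. \<Sum>j\<in>{1..N}. edge_intensity w N i j * min 1 (edge_intensity w N i j))"

definition weighted_spin :: "(nat \<Rightarrow> nat \<Rightarrow> real) \<Rightarrow> nat \<Rightarrow> (nat \<Rightarrow> real) \<Rightarrow> real" where
  "weighted_spin w N \<sigma> = (\<Sum>i\<in>{1..N}. w N i * \<sigma> i)"

definition mean_field_energy ::
    "(nat \<Rightarrow> nat \<Rightarrow> real) \<Rightarrow> real \<Rightarrow> real \<Rightarrow> nat \<Rightarrow> (nat \<Rightarrow> real) \<Rightarrow> real" where
  "mean_field_energy w \<beta> B N \<sigma> =
     sinh \<beta> / (2 * total_weight w N) * (weighted_spin w N \<sigma>)\<^sup>2 + B * total_spin N \<sigma>"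

definition mean_field_partition :: "(nat \<Rightarrow> nat \<Rightarrow> real) \<Rightarrow> real \<Rightarrow> real \<Rightarrow> nat \<Rightarrow> real" where
  "mean_field_partition w \<beta> B N = (\<Sum>\<sigma>\<in>spin_configs N. exp (mean_field_energy w \<beta> B N \<sigma>))"

lemma spin_cases:
  assumes "\<sigma> \<in> spin_configs N" "i \<in> {1..N}"
  shows "\<sigma> i = 1 \<or> \<sigma> i = -1"
  using assms by (auto simp: spin_configs_def PiE_def Pi_def)

text \<open>
  The edges are independent and the Boltzmann factor is a product over edges, so the expectation factorizes.
\<close>

lemma expectation_boltzmann_weight:
  assumes p: "\<And>i j. (i, j) \<in> vertex_pairs N \<Longrightarrow> 0 \<le> edge_prob w N i j \<and> edge_prob w N i j \<le> 1"
  shows "measure_pmf.expectation (GRG w N) (\<lambda>E. boltzmann_weight N E \<beta> B \<sigma>) =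
    exp (B * total_spin N \<sigma>) *
    (\<Prod>(i, j)\<in>vertex_pairs N. 1 - edge_prob w N i j + edge_prob w N i j * exp (\<beta> * (\<sigma> i * \<sigma> j)))"
proof -
  let ?V = "vertex_pairs N"
  let ?p = "\<lambda>(i, j). bernoulli_pmf (edge_prob w N i j)"
  let ?f = "\<lambda>e x. if x then exp (\<beta> * (\<sigma> (fst e) * \<sigma> (snd e))) else 1"
  have eq: "boltzmann_weight N {e. X e} \<beta> B \<sigma> = exp (B * total_spin N \<sigma>) * (\<Prod>e\<in>?V. ?f e (X e))"
    if X: "X \<in> set_pmf (Pi_pmf ?V False ?p)" for X
  proof -
    have "\<forall>e. e \<notin> ?V \<longrightarrow> \<not> X e"
      using subsetD[OF set_Pi_pmf_subset[OF finite_vertex_pairs] X] by auto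
    then have "{e. X e} = {e \<in> ?V. X e}" by auto
    then have "\<beta> * (\<Sum>(i, j)\<in>{e. X e}. \<sigma> i * \<sigma> j)
        = (\<Sum>e\<in>?V. if X e then \<beta> * (\<sigma> (fst e) * \<sigma> (snd e)) else 0)"
      by (simp add: sum.inter_filter[OF finite_vertex_pairs] case_prod_unfold sum_distrib_left if_distrib
          cong: if_cong)
    then have "boltzmann_weight N {e. X e} \<beta> B \<sigma> = exp (B * total_spin N \<sigma>) *
        (\<Prod>e\<in>?V. exp (if X e then \<beta> * (\<sigma> (fst e) * \<sigma> (snd e)) else 0))"
      unfolding boltzmann_weight_def
      by (simp only: exp_add exp_sum[OF finite_vertex_pairs] mult.commute)
    also have "(\<Prod>e\<in>?V. exp (if X e then \<beta> * (\<sigma> (fst e) * \<sigma> (snd e)) else 0)) = (\<Prod>e\<in>?V. ?f e (X e))"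
      by (intro prod.cong) auto
    finally show ?thesis .
  qed
  have "measure_pmf.expectation (GRG w N) (\<lambda>E. boltzmann_weight N E \<beta> B \<sigma>)
      = measure_pmf.expectation (Pi_pmf ?V False ?p) (\<lambda>X. boltzmann_weight N {e. X e} \<beta> B \<sigma>)"
    unfolding GRG_def by simp
  also have "\<dots> = measure_pmf.expectation (Pi_pmf ?V False ?p)
      (\<lambda>X. exp (B * total_spin N \<sigma>) * (\<Prod>e\<in>?V. ?f e (X e)))"
    by (intro integral_cong_AE) (auto simp: AE_measure_pmf_iff eq)
  also have "\<dots> = exp (B * total_spin N \<sigma>) *
      measure_pmf.expectation (Pi_pmf ?V False ?p) (\<lambda>X. \<Prod>e\<in>?V. ?f e (X e))"
    by simp
  also have "measure_pmf.expectation (Pi_pmf ?V False ?p) (\<lambda>X. \<Prod>e\<in>?V. ?f e (X e))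
      = (\<Prod>e\<in>?V. measure_pmf.expectation (?p e) (?f e))"
    by (intro expectation_prod_Pi_pmf finite_vertex_pairs)
       (auto intro!: integrable_measure_pmf_finite)
  also have "\<dots> = (\<Prod>(i, j)\<in>?V. 1 - edge_prob w N i j + edge_prob w N i j * exp (\<beta> * (\<sigma> i * \<sigma> j)))"
    by (intro prod.cong) (use p in \<open>auto simp: algebra_simps\<close>)
  finally show ?thesis .
qed

lemma ln_one_plus_approx:
  fixes z :: real assumes "0 \<le> z" shows "\<bar>ln (1 + z) - z\<bar> \<le> z * min 1 z"
proof (cases "z \<le> 1")
  case True
  then show ?thesis using abs_ln_one_plus_x_minus_x_bound_nonneg[OF assms True]
    by (simp add: power2_eq_square)
next
  case False
  have "0 \<le> ln (1 + z)" "ln (1 + z) \<le> z" using assms by (auto intro: ln_add_one_self_le_self)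
  with False show ?thesis by simp
qed

text \<open>
  A single edge contributes \<open>(1 + q e\<^sup>x) / (1 + q)\<close> to the annealed weight, where \<open>q\<close> is the intensity of the
  edge; to first order in \<open>q\<close> its logarithm is \<open>q (e\<^sup>x - 1)\<close>.
\<close>

lemma ln_edge_factor_approx:
  fixes q x K :: real
  assumes q: "0 \<le> q" and x: "exp x \<le> K" and K: "1 \<le> K"
  shows "\<bar>ln ((1 + q * exp x) / (1 + q)) - q * (exp x - 1)\<bar> \<le> 2 * K\<^sup>2 * (q * min 1 q)"
proof -
  have z: "0 \<le> q * exp x" "q * exp x \<le> K * q"
    using q mult_left_mono[OF x q] by (simp_all add: mult.commute)
  have "q * exp x * min 1 (q * exp x) \<le> (K * q) * (K * min 1 q)"
  proof (rule mult_mono)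
    have "K * 1 \<ge> 1" using K by simp
    then show "min 1 (q * exp x) \<le> K * min 1 q" using z K q by (auto simp: min_def)
  qed (use z K q in auto)
  moreover have "1 * (q * min 1 q) \<le> K\<^sup>2 * (q * min 1 q)"
    using K q by (intro mult_right_mono) (auto simp: one_le_power)
  moreover have "ln ((1 + q * exp x) / (1 + q)) = ln (1 + q * exp x) - ln (1 + q)"
  proof -
    have "0 < 1 + q * exp x" "0 < 1 + q" using q z by linarith+
    then show ?thesis by (simp add: ln_div)
  qed
  moreover note ln_one_plus_approx[OF z(1)] ln_one_plus_approx[OF q]
  ultimately show ?thesis by (simp add: power2_eq_square algebra_simps abs_le_iff)
qed

text \<open>
  Turns the pair interaction into a complete square; the diagonal is harmless because \<open>\<sigma>\<^sub>i\<^sup>2 = 1\<close>.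
\<close>

lemma square_sum_vertex_pairs:
  fixes a :: "nat \<Rightarrow> real"
  shows "(\<Sum>i\<in>{1..N}. a i)\<^sup>2 = 2 * (\<Sum>(i, j)\<in>vertex_pairs N. a i * a j) + (\<Sum>i\<in>{1..N}. (a i)\<^sup>2)"
proof (induction N)
  case 0
  have "vertex_pairs 0 = {}" by (auto simp: vertex_pairs_def)
  then show ?case by simp
next
  case (Suc N)
  have split: "vertex_pairs (Suc N) = vertex_pairs N \<union> (\<lambda>i. (i, Suc N)) ` {1..N}"
    by (auto simp: vertex_pairs_def)
  have "(\<Sum>(i, j)\<in>vertex_pairs (Suc N). a i * a j)
      = (\<Sum>(i, j)\<in>vertex_pairs N. a i * a j) + (\<Sum>(i, j)\<in>(\<lambda>i. (i, Suc N)) ` {1..N}. a i * a j)"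
    unfolding split by (intro sum.union_disjoint) (auto simp: finite_vertex_pairs, auto simp: vertex_pairs_def)
  also have "(\<Sum>(i, j)\<in>(\<lambda>i. (i, Suc N)) ` {1..N}. a i * a j) = (\<Sum>i\<in>{1..N}. a i) * a (Suc N)"
    by (subst sum.reindex) (auto simp: inj_on_def sum_distrib_right)
  finally show ?case using Suc by (simp add: power2_eq_square algebra_simps)
qed

context
  fixes w :: "nat \<Rightarrow> nat \<Rightarrow> real" and N :: nat
  assumes pos: "\<And>i. 1 \<le> i \<Longrightarrow> i \<le> N \<Longrightarrow> 0 < w N i" and N: "1 \<le> N"
begin

lemma total_weight_pos: "0 < total_weight w N"
  unfolding total_weight_def using pos N by (intro sum_pos) auto

lemma edge_intensity_nonneg:
  "i \<in> {1..N} \<Longrightarrow> j \<in> {1..N} \<Longrightarrow> 0 \<le> edge_intensity w N i j"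
  unfolding edge_intensity_def using total_weight_pos pos by (simp add: less_imp_le)

lemma edge_factor:
  assumes "(i, j) \<in> vertex_pairs N"
  shows "1 - edge_prob w N i j + edge_prob w N i j * y
      = (1 + edge_intensity w N i j * y) / (1 + edge_intensity w N i j)"
    and "0 \<le> edge_prob w N i j \<and> edge_prob w N i j \<le> 1"
proof -
  have ij: "0 < w N i * w N j" using assms pos by (auto simp: vertex_pairs_def)
  with total_weight_pos show "0 \<le> edge_prob w N i j \<and> edge_prob w N i j \<le> 1"
    unfolding edge_prob_def by simp
  define l x where "l = total_weight w N" and "x = w N i * w N j"
  have "0 < l" "0 < x" using ij total_weight_pos by (auto simp: l_def x_def)
  then have "1 - x / (l + x) + x / (l + x) * y = (1 + x / l * y) / (1 + x / l)"
    by (simp add: divide_simps)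
  then show "1 - edge_prob w N i j + edge_prob w N i j * y
      = (1 + edge_intensity w N i j * y) / (1 + edge_intensity w N i j)"
    unfolding edge_prob_def edge_intensity_def l_def x_def .
qed

text \<open>
  A function of a sign is affine in that sign; this is where \<open>sinh \<beta>\<close> replaces \<open>\<beta>\<close> as the effective coupling.
\<close>

lemma exp_spin_product:
  assumes "\<sigma> \<in> spin_configs N" "(i, j) \<in> vertex_pairs N"
  shows "exp (\<beta> * (\<sigma> i * \<sigma> j)) = cosh \<beta> + sinh \<beta> * (\<sigma> i * \<sigma> j)"
proof -
  have "\<sigma> i * \<sigma> j = 1 \<or> \<sigma> i * \<sigma> j = -1"
    using spin_cases[OF assms(1), of i] spin_cases[OF assms(1), of j] assms(2) by (auto simp: vertex_pairs_def)
  then show ?thesis using cosh_plus_sinh[of \<beta>] cosh_minus_sinh[of \<beta>] by auto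
qed

lemma sum_edge_intensity_spins:
  assumes \<sigma>: "\<sigma> \<in> spin_configs N"
  shows "(\<Sum>(i, j)\<in>vertex_pairs N. edge_intensity w N i j * (\<sigma> i * \<sigma> j))
    = ((weighted_spin w N \<sigma>)\<^sup>2 - (\<Sum>i\<in>{1..N}. (w N i)\<^sup>2)) / (2 * total_weight w N)"
proof -
  have "(\<Sum>(i, j)\<in>vertex_pairs N. edge_intensity w N i j * (\<sigma> i * \<sigma> j))
      = (\<Sum>(i, j)\<in>vertex_pairs N. (w N i * \<sigma> i) * (w N j * \<sigma> j)) / total_weight w N"
    by (simp add: sum_divide_distrib case_prod_unfold edge_intensity_def algebra_simps)
  moreover have "(\<Sum>i\<in>{1..N}. (w N i * \<sigma> i)\<^sup>2) = (\<Sum>i\<in>{1..N}. (w N i)\<^sup>2)"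
    using spin_cases[OF \<sigma>] by (intro sum.cong) (fastforce simp: power_mult_distrib)+
  ultimately show ?thesis
    using square_sum_vertex_pairs[of "\<lambda>i. w N i * \<sigma> i" N] total_weight_pos
    by (simp add: weighted_spin_def field_simps)
qed

text \<open>
  The additive constant \<open>A\<close> does not depend on the configuration, so it cancels in the normalized measure.
\<close>

lemma ln_expectation_boltzmann_weight_approx:
  assumes \<beta>: "0 \<le> \<beta>"
  obtains A where "\<And>B \<sigma>. \<sigma> \<in> spin_configs N \<Longrightarrow>
    \<bar>ln (measure_pmf.expectation (GRG w N) (\<lambda>E. boltzmann_weight N E \<beta> B \<sigma>))
      - (A + mean_field_energy w \<beta> B N \<sigma>)\<bar> \<le> 2 * (exp \<beta>)\<^sup>2 * intensity_error w N"
proof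
  let ?q = "edge_intensity w N" and ?V = "vertex_pairs N"
  fix B \<sigma> assume \<sigma>: "\<sigma> \<in> spin_configs N"
  define F where "F = (\<lambda>(i, j). (1 + ?q i j * exp (\<beta> * (\<sigma> i * \<sigma> j))) / (1 + ?q i j))"
  have mem: "i \<in> {1..N}" "j \<in> {1..N}" if "(i, j) \<in> ?V" for i j
    using that by (auto simp: vertex_pairs_def)
  have q0: "0 \<le> ?q i j" if "(i, j) \<in> ?V" for i j
    using mem[OF that] by (rule edge_intensity_nonneg)
  have Fpos: "0 < F e" if "e \<in> ?V" for e
    using q0 that by (cases e) (auto simp: F_def intro!: divide_pos_pos add_pos_nonneg)
  have "measure_pmf.expectation (GRG w N) (\<lambda>E. boltzmann_weight N E \<beta> B \<sigma>)
      = exp (B * total_spin N \<sigma>) * (\<Prod>e\<in>?V. F e)"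
    unfolding F_def
    by (subst expectation_boltzmann_weight) (auto simp: edge_factor intro!: prod.cong)
  also have "ln \<dots> = B * total_spin N \<sigma> + (\<Sum>e\<in>?V. ln (F e))"
  proof -
    have "0 < (\<Prod>e\<in>?V. F e)" using Fpos by (intro prod_pos) auto
    moreover have "ln (\<Prod>e\<in>?V. F e) = (\<Sum>e\<in>?V. ln (F e))"
      using Fpos by (intro ln_prod finite_vertex_pairs) (metis less_irrefl)
    ultimately show ?thesis by (simp add: ln_mult)
  qed
  finally have ln: "ln (measure_pmf.expectation (GRG w N) (\<lambda>E. boltzmann_weight N E \<beta> B \<sigma>))
      = B * total_spin N \<sigma> + (\<Sum>e\<in>?V. ln (F e))" .
  have "\<bar>(\<Sum>e\<in>?V. ln (F e)) - (\<Sum>(i, j)\<in>?V. ?q i j * (exp (\<beta> * (\<sigma> i * \<sigma> j)) - 1))\<bar>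
      \<le> (\<Sum>(i, j)\<in>?V. 2 * (exp \<beta>)\<^sup>2 * (?q i j * min 1 (?q i j)))"
    unfolding sum_subtractf[symmetric]
  proof (rule order_trans[OF sum_abs sum_mono], clarify)
    fix i j assume ij: "(i, j) \<in> ?V"
    have "\<sigma> i * \<sigma> j \<le> 1"
      using spin_cases[OF \<sigma> mem(1)[OF ij]] spin_cases[OF \<sigma> mem(2)[OF ij]] by auto
    then have "exp (\<beta> * (\<sigma> i * \<sigma> j)) \<le> exp \<beta>" using \<beta> by (simp add: mult_left_le)
    then show "\<bar>ln (F (i, j)) - ?q i j * (exp (\<beta> * (\<sigma> i * \<sigma> j)) - 1)\<bar>
        \<le> 2 * (exp \<beta>)\<^sup>2 * (?q i j * min 1 (?q i j))"
      unfolding F_def using q0[OF ij] \<beta> by (simp add: ln_edge_factor_approx)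
  qed
  also have "\<dots> \<le> (\<Sum>(i, j)\<in>{1..N} \<times> {1..N}. 2 * (exp \<beta>)\<^sup>2 * (?q i j * min 1 (?q i j)))"
  proof (rule sum_mono2)
    show "0 \<le> (case e of (i, j) \<Rightarrow> 2 * (exp \<beta>)\<^sup>2 * (?q i j * min 1 (?q i j)))"
      if "e \<in> {1..N} \<times> {1..N} - ?V" for e
      using that edge_intensity_nonneg by auto
  qed (use mem in auto)
  also have "\<dots> = 2 * (exp \<beta>)\<^sup>2 * intensity_error w N"
    by (simp add: intensity_error_def sum.cartesian_product sum_distrib_left case_prod_unfold)
  finally have err: "\<bar>(\<Sum>e\<in>?V. ln (F e)) - (\<Sum>(i, j)\<in>?V. ?q i j * (exp (\<beta> * (\<sigma> i * \<sigma> j)) - 1))\<bar>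
      \<le> 2 * (exp \<beta>)\<^sup>2 * intensity_error w N" .
  have "(\<Sum>(i, j)\<in>?V. ?q i j * (exp (\<beta> * (\<sigma> i * \<sigma> j)) - 1))
      = (\<Sum>(i, j)\<in>?V. (cosh \<beta> - 1) * ?q i j + sinh \<beta> * (?q i j * (\<sigma> i * \<sigma> j)))"
    by (intro sum.cong) (auto simp: exp_spin_product[OF \<sigma>] algebra_simps)
  also have "\<dots> = (cosh \<beta> - 1) * (\<Sum>(i, j)\<in>?V. ?q i j)
      + sinh \<beta> * (((weighted_spin w N \<sigma>)\<^sup>2 - (\<Sum>i\<in>{1..N}. (w N i)\<^sup>2)) / (2 * total_weight w N))"
    unfolding sum_edge_intensity_spins[OF \<sigma>, symmetric]
    by (simp add: sum.distrib sum_distrib_left case_prod_unfold)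
  also have "\<dots> = ((cosh \<beta> - 1) * (\<Sum>(i, j)\<in>?V. ?q i j)
        - sinh \<beta> * (\<Sum>i\<in>{1..N}. (w N i)\<^sup>2) / (2 * total_weight w N))
      + sinh \<beta> / (2 * total_weight w N) * (weighted_spin w N \<sigma>)\<^sup>2"
    by (simp add: diff_divide_distrib algebra_simps)
  finally have "(\<Sum>(i, j)\<in>?V. ?q i j * (exp (\<beta> * (\<sigma> i * \<sigma> j)) - 1)) + B * total_spin N \<sigma>
      = ((cosh \<beta> - 1) * (\<Sum>(i, j)\<in>?V. ?q i j)
        - sinh \<beta> * (\<Sum>i\<in>{1..N}. (w N i)\<^sup>2) / (2 * total_weight w N)) + mean_field_energy w \<beta> B N \<sigma>"
    unfolding mean_field_energy_def by simp
  with err ln show "\<bar>ln (measure_pmf.expectation (GRG w N) (\<lambda>E. boltzmann_weight N E \<beta> B \<sigma>))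
      - (((cosh \<beta> - 1) * (\<Sum>(i, j)\<in>?V. ?q i j)
        - sinh \<beta> * (\<Sum>i\<in>{1..N}. (w N i)\<^sup>2) / (2 * total_weight w N)) + mean_field_energy w \<beta> B N \<sigma>)\<bar>
      \<le> 2 * (exp \<beta>)\<^sup>2 * intensity_error w N" by linarith
qed

text \<open>
  The approximation error enters once through the numerator and once through the normalization, which doubles it.
\<close>

lemma annealed_weight_le_mean_field:
  assumes \<beta>: "0 \<le> \<beta>" and \<sigma>: "\<sigma> \<in> spin_configs N"
  shows "annealed_weight w \<beta> B N \<sigma> \<le> exp (4 * (exp \<beta>)\<^sup>2 * intensity_error w N) *
    (exp (mean_field_energy w \<beta> B N \<sigma>) / mean_field_partition w \<beta> B N)"
proof -
  define e where "e = 2 * (exp \<beta>)\<^sup>2 * intensity_error w N"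
  let ?E = "\<lambda>\<sigma>. measure_pmf.expectation (GRG w N) (\<lambda>E. boltzmann_weight N E \<beta> B \<sigma>)"
  obtain A where A: "\<And>\<sigma>. \<sigma> \<in> spin_configs N \<Longrightarrow> \<bar>ln (?E \<sigma>) - (A + mean_field_energy w \<beta> B N \<sigma>)\<bar> \<le> e"
    using ln_expectation_boltzmann_weight_approx[OF \<beta>] unfolding e_def by metis
  have E: "exp (A - e) * exp (mean_field_energy w \<beta> B N \<sigma>) \<le> ?E \<sigma>"
    "?E \<sigma> \<le> exp (A + e) * exp (mean_field_energy w \<beta> B N \<sigma>)" if "\<sigma> \<in> spin_configs N" for \<sigma>
  proof -
    have "?E \<sigma> = exp (ln (?E \<sigma>))" using expectation_boltzmann_weight_pos by simp
    with A[OF that] show "exp (A - e) * exp (mean_field_energy w \<beta> B N \<sigma>) \<le> ?E \<sigma>"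
      "?E \<sigma> \<le> exp (A + e) * exp (mean_field_energy w \<beta> B N \<sigma>)"
      by (smt (verit) exp_le_cancel_iff exp_add)+
  qed
  have Zpos: "0 < mean_field_partition w \<beta> B N"
    unfolding mean_field_partition_def by (intro sum_pos finite_spin_configs spin_configs_nonempty) auto
  have "exp (A - e) * mean_field_partition w \<beta> B N \<le> (\<Sum>\<sigma>\<in>spin_configs N. ?E \<sigma>)"
    unfolding mean_field_partition_def sum_distrib_left by (intro sum_mono E(1))
  then have "annealed_weight w \<beta> B N \<sigma>
      \<le> (exp (A + e) * exp (mean_field_energy w \<beta> B N \<sigma>)) / (exp (A - e) * mean_field_partition w \<beta> B N)"
    unfolding annealed_weight_def expectation_partition_function
    using Zpos by (intro frac_le E(2)[OF \<sigma>]) auto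
  also have "\<dots> = exp (A + e) / exp (A - e) * (exp (mean_field_energy w \<beta> B N \<sigma>) / mean_field_partition w \<beta> B N)"
    by simp
  also have "exp (A + e) / exp (A - e) = exp (2 * e)" by (simp flip: exp_diff)
  also have "2 * e = 4 * (exp \<beta>)\<^sup>2 * intensity_error w N" by (simp add: e_def)
  finally show ?thesis .
qed

end

section \<open>Linearization of the quadratic energy\<close>

definition empirical_mean :: "(nat \<Rightarrow> nat \<Rightarrow> real) \<Rightarrow> nat \<Rightarrow> (real \<Rightarrow> real) \<Rightarrow> real" where
  "empirical_mean w N f = (\<Sum>i\<in>{1..N}. f (w N i)) / real N"

text \<open>The counterpart of the parameter \<open>r\<close> for \<open>N\<close> vertices.\<close>

definition coupling :: "(nat \<Rightarrow> nat \<Rightarrow> real) \<Rightarrow> real \<Rightarrow> nat \<Rightarrow> real" where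
  "coupling w \<beta> N = sqrt (sinh \<beta> / (total_weight w N / real N))"

definition empirical_free_energy :: "(nat \<Rightarrow> nat \<Rightarrow> real) \<Rightarrow> real \<Rightarrow> nat \<Rightarrow> real \<Rightarrow> real \<Rightarrow> real" where
  "empirical_free_energy w \<beta> N B u =
     empirical_mean w N (\<lambda>x. ln (cosh (B + coupling w \<beta> N * u * x))) - u\<^sup>2 / 2"

lemma sum_exp_linear_spins:
  "(\<Sum>\<sigma>\<in>spin_configs N. exp (\<Sum>i\<in>{1..N}. a i * \<sigma> i)) = 2 ^ N * exp (\<Sum>i\<in>{1..N}. ln (cosh (a i)))"
proof -
  have "(\<Sum>\<sigma>\<in>spin_configs N. exp (\<Sum>i\<in>{1..N}. a i * \<sigma> i))
      = (\<Sum>\<sigma>\<in>spin_configs N. \<Prod>i\<in>{1..N}. exp (a i * \<sigma> i))"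
    by (simp add: exp_sum)
  also have "\<dots> = (\<Prod>i\<in>{1..N}. \<Sum>x\<in>{-1, 1}. exp (a i * x))"
    unfolding spin_configs_def by (rule prod_sum_PiE[symmetric]) auto
  also have "\<dots> = (\<Prod>i\<in>{1..N}. 2 * exp (ln (cosh (a i))))"
  proof (intro prod.cong refl)
    fix i
    have "2 * exp (ln (cosh (a i))) = 2 * cosh (a i)" by (simp add: cosh_real_pos)
    then show "(\<Sum>x\<in>{-1, 1}. exp (a i * x)) = 2 * exp (ln (cosh (a i)))" by (simp add: cosh_field_def)
  qed
  also have "\<dots> = 2 ^ N * exp (\<Sum>i\<in>{1..N}. ln (cosh (a i)))"
    by (simp add: prod.distrib exp_sum)
  finally show ?thesis .
qed

lemma measure_annealed_ising:
  assumes "A \<subseteq> spin_configs N"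
  shows "measure (annealed_ising w \<beta> B N) A = (\<Sum>\<sigma>\<in>A. annealed_weight w \<beta> B N \<sigma>)"
proof -
  have fin: "finite A" using assms finite_spin_configs by (rule finite_subset)
  have "emeasure (annealed_ising w \<beta> B N) A = (\<Sum>\<sigma>\<in>A. ennreal (annealed_weight w \<beta> B N \<sigma>))"
    unfolding annealed_ising_def by (rule emeasure_point_measure_finite[OF finite_spin_configs assms])
  also have "\<dots> = ennreal (\<Sum>\<sigma>\<in>A. annealed_weight w \<beta> B N \<sigma>)"
    by (intro sum_ennreal) (auto intro: less_imp_le[OF annealed_weight_pos])
  finally show ?thesis
    by (intro measure_eq_emeasure_eq_ennreal sum_nonneg less_imp_le[OF annealed_weight_pos])
qed

context
  fixes w :: "nat \<Rightarrow> nat \<Rightarrow> real" and N :: nat and \<beta> :: real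
  assumes pos: "\<And>i. 1 \<le> i \<Longrightarrow> i \<le> N \<Longrightarrow> 0 < w N i" and N: "1 \<le> N" and \<beta>: "0 \<le> \<beta>"
begin

lemma total_weight_pos': "0 < total_weight w N"
  by (rule total_weight_pos[where w = w and N = N, OF pos N])

lemma mean_field_energy_square:
  "mean_field_energy w \<beta> B N \<sigma> =
     real N * (coupling w \<beta> N * weighted_spin w N \<sigma> / real N)\<^sup>2 / 2 + B * total_spin N \<sigma>"
proof -
  have "(coupling w \<beta> N)\<^sup>2 = sinh \<beta> / (total_weight w N / real N)"
    unfolding coupling_def using \<beta> total_weight_pos' by (simp add: less_imp_le)
  moreover have "real N * (c * y / real N)\<^sup>2 / 2 = c\<^sup>2 * y\<^sup>2 / (2 * real N)" for c y :: real
    using N by (simp add: power2_eq_square mult_ac)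
  ultimately show ?thesis
    unfolding mean_field_energy_def using N by simp
qed

text \<open>
  Once the square of the weighted spin is replaced by a linear function with slope \<open>u\<close>, the spins decouple.
\<close>

lemma sum_exp_linearized_energy:
  "(\<Sum>\<sigma>\<in>spin_configs N. exp (real N * (u * (coupling w \<beta> N * weighted_spin w N \<sigma> / real N) - u\<^sup>2 / 2)
      + B * total_spin N \<sigma>)) = 2 ^ N * exp (real N * empirical_free_energy w \<beta> N B u)"
proof -
  have "real N * (u * (coupling w \<beta> N * weighted_spin w N \<sigma> / real N) - u\<^sup>2 / 2) + B * total_spin N \<sigma>
      = (\<Sum>i\<in>{1..N}. (B + coupling w \<beta> N * u * w N i) * \<sigma> i) - real N * (u\<^sup>2 / 2)" for \<sigma>
  proof -
    have "real N * (u * (coupling w \<beta> N * weighted_spin w N \<sigma> / real N) - u\<^sup>2 / 2)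
        = coupling w \<beta> N * u * weighted_spin w N \<sigma> - real N * (u\<^sup>2 / 2)"
      using N by (simp add: right_diff_distrib)
    moreover have "(\<Sum>i\<in>{1..N}. (B + coupling w \<beta> N * u * w N i) * \<sigma> i)
        = B * total_spin N \<sigma> + coupling w \<beta> N * u * weighted_spin w N \<sigma>"
      unfolding total_spin_def weighted_spin_def
      by (simp add: distrib_right sum.distrib sum_distrib_left mult.assoc)
    ultimately show ?thesis by simp
  qed
  then have "(\<Sum>\<sigma>\<in>spin_configs N. exp (real N * (u * (coupling w \<beta> N * weighted_spin w N \<sigma> / real N) - u\<^sup>2 / 2)
        + B * total_spin N \<sigma>))
      = (\<Sum>\<sigma>\<in>spin_configs N. exp (\<Sum>i\<in>{1..N}. (B + coupling w \<beta> N * u * w N i) * \<sigma> i)) / exp (real N * (u\<^sup>2 / 2))"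
    by (simp only: exp_diff sum_divide_distrib)
  also have "\<dots> = 2 ^ N * exp (real N * empirical_free_energy w \<beta> N B u)"
    unfolding sum_exp_linear_spins empirical_free_energy_def empirical_mean_def
    using N by (simp add: right_diff_distrib exp_diff)
  finally show ?thesis .
qed

text \<open>
  Every tangent lies below the parabola: \<open>u y - u\<^sup>2 / 2 \<le> y\<^sup>2 / 2\<close>.
\<close>

lemma mean_field_partition_lower:
  "2 ^ N * exp (real N * empirical_free_energy w \<beta> N B u) \<le> mean_field_partition w \<beta> B N"
  unfolding sum_exp_linearized_energy[symmetric] mean_field_partition_def
proof (intro sum_mono, subst exp_le_cancel_iff, unfold mean_field_energy_square)
  fix \<sigma>
  let ?y = "coupling w \<beta> N * weighted_spin w N \<sigma> / real N"
  have "u * y - u\<^sup>2 / 2 \<le> y\<^sup>2 / 2" for y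
    using zero_le_power2[of "u - y"] by (simp add: power2_diff)
  from this[of ?y] have "u * ?y - u\<^sup>2 / 2 \<le> ?y\<^sup>2 / 2" .
  then have "real N * (u * ?y - u\<^sup>2 / 2) \<le> real N * (?y\<^sup>2 / 2)"
    by (intro mult_left_mono) auto
  then show "real N * (u * ?y - u\<^sup>2 / 2) + B * total_spin N \<sigma> \<le> real N * ?y\<^sup>2 / 2 + B * total_spin N \<sigma>"
    by simp
qed

lemma weighted_spin_bound:
  assumes "\<sigma> \<in> spin_configs N"
  shows "\<bar>weighted_spin w N \<sigma>\<bar> \<le> total_weight w N"
proof -
  have "\<bar>weighted_spin w N \<sigma>\<bar> \<le> (\<Sum>i\<in>{1..N}. \<bar>w N i * \<sigma> i\<bar>)"
    unfolding weighted_spin_def by (rule sum_abs)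
  also have "\<dots> = total_weight w N"
    unfolding total_weight_def
  proof (intro sum.cong refl)
    fix i assume i: "i \<in> {1..N}"
    with pos[of i] spin_cases[OF assms i] show "\<bar>w N i * \<sigma> i\<bar> = w N i" by auto
  qed
  finally show ?thesis .
qed

text \<open>
  The tangent at a point within distance \<open>\<delta>\<close> of \<open>y\<close> misses \<open>y\<^sup>2 / 2\<close> by at most \<open>\<delta>\<^sup>2 / 2\<close>. As the rescaled weighted
  spin stays bounded, finitely many tangents suffice for all configurations, and the maximum over them costs only
  the factor \<open>card G\<close>.
\<close>

lemma mean_field_partition_upper:
  assumes G: "finite G" "\<And>y. \<bar>y\<bar> \<le> C \<Longrightarrow> \<exists>u\<in>G. \<bar>y - u\<bar> \<le> \<delta>"
    and C: "coupling w \<beta> N * (total_weight w N / real N) \<le> C"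
    and M: "\<And>u. u \<in> G \<Longrightarrow> empirical_free_energy w \<beta> N B u \<le> M"
  shows "mean_field_partition w \<beta> B N \<le> real (card G) * (2 ^ N * exp (real N * (M + \<delta>\<^sup>2 / 2)))"
proof -
  let ?y = "\<lambda>\<sigma>. coupling w \<beta> N * weighted_spin w N \<sigma> / real N"
  let ?e = "\<lambda>u \<sigma>. exp (real N * (u * ?y \<sigma> - u\<^sup>2 / 2) + B * total_spin N \<sigma>)"
  have c0: "0 \<le> coupling w \<beta> N"
    unfolding coupling_def using \<beta> total_weight_pos' by (simp add: less_imp_le)
  have "exp (mean_field_energy w \<beta> B N \<sigma>) \<le> exp (real N * (\<delta>\<^sup>2 / 2)) * (\<Sum>u\<in>G. ?e u \<sigma>)"
    if \<sigma>: "\<sigma> \<in> spin_configs N" for \<sigma>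
  proof -
    have "\<bar>?y \<sigma>\<bar> = coupling w \<beta> N * (\<bar>weighted_spin w N \<sigma>\<bar> / real N)"
      using c0 by (simp add: abs_mult)
    also have "\<dots> \<le> coupling w \<beta> N * (total_weight w N / real N)"
      by (intro mult_left_mono divide_right_mono weighted_spin_bound[OF \<sigma>] c0) auto
    finally obtain u where u: "u \<in> G" "\<bar>?y \<sigma> - u\<bar> \<le> \<delta>" using C G(2) by (meson order_trans)
    have "y\<^sup>2 / 2 \<le> \<delta>\<^sup>2 / 2 + (u * y - u\<^sup>2 / 2)" if y: "\<bar>y - u\<bar> \<le> \<delta>" for y
    proof -
      have "(y - u)\<^sup>2 \<le> \<delta>\<^sup>2" using y by (simp add: abs_le_square_iff[symmetric])
      then show ?thesis by (simp add: power2_diff mult.commute)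
    qed
    from this[OF u(2)] have "(?y \<sigma>)\<^sup>2 / 2 \<le> \<delta>\<^sup>2 / 2 + (u * ?y \<sigma> - u\<^sup>2 / 2)" .
    then have "real N * ((?y \<sigma>)\<^sup>2 / 2) \<le> real N * (\<delta>\<^sup>2 / 2 + (u * ?y \<sigma> - u\<^sup>2 / 2))"
      by (intro mult_left_mono) auto
    then have "mean_field_energy w \<beta> B N \<sigma>
        \<le> real N * (\<delta>\<^sup>2 / 2) + (real N * (u * ?y \<sigma> - u\<^sup>2 / 2) + B * total_spin N \<sigma>)"
      unfolding mean_field_energy_square by (simp add: distrib_left)
    then have "exp (mean_field_energy w \<beta> B N \<sigma>) \<le> exp (real N * (\<delta>\<^sup>2 / 2)) * ?e u \<sigma>"
      by (simp flip: exp_add)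
    also have "?e u \<sigma> \<le> (\<Sum>u\<in>G. ?e u \<sigma>)" using u G by (intro member_le_sum) auto
    finally show ?thesis by simp
  qed
  then have "mean_field_partition w \<beta> B N
      \<le> (\<Sum>\<sigma>\<in>spin_configs N. exp (real N * (\<delta>\<^sup>2 / 2)) * (\<Sum>u\<in>G. ?e u \<sigma>))"
    unfolding mean_field_partition_def by (intro sum_mono) auto
  also have "\<dots> = exp (real N * (\<delta>\<^sup>2 / 2)) * (\<Sum>u\<in>G. \<Sum>\<sigma>\<in>spin_configs N. ?e u \<sigma>)"
    unfolding sum_distrib_left[symmetric] by (subst sum.swap) simp
  also have "\<dots> = exp (real N * (\<delta>\<^sup>2 / 2)) * (\<Sum>u\<in>G. 2 ^ N * exp (real N * empirical_free_energy w \<beta> N B u))"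
    unfolding sum_exp_linearized_energy ..
  also have "\<dots> \<le> exp (real N * (\<delta>\<^sup>2 / 2)) * (\<Sum>u\<in>G. 2 ^ N * exp (real N * M))"
    using M by (intro mult_left_mono sum_mono) (auto intro!: mult_left_mono)
  also have "\<dots> = real (card G) * (2 ^ N * exp (real N * (M + \<delta>\<^sup>2 / 2)))"
    by (simp add: distrib_left exp_add)
  finally show ?thesis .
qed

lemma mean_field_partition_pos: "0 < mean_field_partition w \<beta> B N"
  unfolding mean_field_partition_def by (intro sum_pos finite_spin_configs spin_configs_nonempty) auto

text \<open>
  Tilting by \<open>exp (t S)\<close> amounts to shifting the external field from \<open>B\<close> to \<open>B + t\<close>.
\<close>

lemma annealed_exponential_Chebyshev:
  "measure (annealed_ising w \<beta> B N) {\<sigma> \<in> spin_configs N. t * total_spin N \<sigma> \<ge> a}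
    \<le> exp (4 * (exp \<beta>)\<^sup>2 * intensity_error w N - a) *
      (mean_field_partition w \<beta> (B + t) N / mean_field_partition w \<beta> B N)"
proof -
  let ?A = "{\<sigma> \<in> spin_configs N. t * total_spin N \<sigma> \<ge> a}"
  let ?e = "4 * (exp \<beta>)\<^sup>2 * intensity_error w N" and ?Z = "mean_field_partition w \<beta> B N"
  have "measure (annealed_ising w \<beta> B N) ?A = (\<Sum>\<sigma>\<in>?A. annealed_weight w \<beta> B N \<sigma>)"
    by (rule measure_annealed_ising) auto
  also have "\<dots> \<le> (\<Sum>\<sigma>\<in>?A. exp (?e - a) * (exp (mean_field_energy w \<beta> (B + t) N \<sigma>) / ?Z))"
  proof (rule sum_mono)
    fix \<sigma> assume \<sigma>: "\<sigma> \<in> ?A"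
    then have "annealed_weight w \<beta> B N \<sigma> \<le> exp ?e * (exp (mean_field_energy w \<beta> B N \<sigma>) / ?Z)"
      by (intro annealed_weight_le_mean_field[where w = w and N = N, OF pos N \<beta>]) auto
    also have "exp ?e * (exp (mean_field_energy w \<beta> B N \<sigma>) / ?Z) = exp (?e + mean_field_energy w \<beta> B N \<sigma>) / ?Z"
      by (simp add: exp_add)
    also have "\<dots> \<le> exp ((?e - a) + mean_field_energy w \<beta> (B + t) N \<sigma>) / ?Z"
      using \<sigma> mean_field_partition_pos[of B]
      by (intro divide_right_mono) (auto simp: mean_field_energy_def algebra_simps)
    also have "\<dots> = exp (?e - a) * (exp (mean_field_energy w \<beta> (B + t) N \<sigma>) / ?Z)"
      by (simp only: exp_add times_divide_eq_right)
    finally show "annealed_weight w \<beta> B N \<sigma>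
        \<le> exp (?e - a) * (exp (mean_field_energy w \<beta> (B + t) N \<sigma>) / ?Z)" .
  qed
  also have "\<dots> \<le> (\<Sum>\<sigma>\<in>spin_configs N. exp (?e - a) * (exp (mean_field_energy w \<beta> (B + t) N \<sigma>) / ?Z))"
    using mean_field_partition_pos[of B]
    by (intro sum_mono2 finite_spin_configs) (auto intro!: mult_nonneg_nonneg divide_nonneg_pos)
  also have "\<dots> = exp (?e - a) * (mean_field_partition w \<beta> (B + t) N / ?Z)"
    unfolding mean_field_partition_def[of w \<beta> "B + t"] by (simp only: sum_distrib_left sum_divide_distrib)
  finally show ?thesis .
qed

end

section \<open>Large-size limits under weight regularity\<close>

definition truncate :: "real \<Rightarrow> real \<Rightarrow> real" where
  "truncate k x = max 0 (min x k)"

lemma integral_weight_law: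
  assumes "f \<in> borel_measurable borel" "1 \<le> N"
  shows "integral\<^sup>L (weight_law w N) f = empirical_mean w N f"
proof -
  have "integral\<^sup>L (weight_law w N) f = measure_pmf.expectation (pmf_of_set {1..N}) (\<lambda>i. f (w N i))"
    unfolding weight_law_def using assms by (intro integral_distr) auto
  also have "\<dots> = empirical_mean w N f"
    unfolding empirical_mean_def using assms by (subst integral_pmf_of_set) auto
  finally show ?thesis .
qed

locale regular_weights =
  fixes w :: "nat \<Rightarrow> nat \<Rightarrow> real" and P :: "'a measure" and W :: "'a \<Rightarrow> real"
  assumes w_pos: "\<And>N i. 1 \<le> i \<Longrightarrow> i \<le> N \<Longrightarrow> 0 < w N i"
    and regular: "weight_regularity w P W"
begin

sublocale prob_space P using regular by (simp add: weight_regularity_def)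

lemma W_measurable [measurable]: "W \<in> borel_measurable P"
  and W_int [simp]: "integrable P W"
  and W2_int: "integrable P (\<lambda>x. (W x)\<^sup>2)"
  and W_mean_pos: "0 < expectation W"
  and mean_weight_tendsto: "(\<lambda>N. total_weight w N / real N) \<longlonglongrightarrow> expectation W"
  using regular by (auto simp: weight_regularity_def total_weight_def)

lemma empirical_mean_tendsto_bounded:
  assumes cont: "\<And>x. isCont f x" and bdd: "\<And>x. \<bar>f x\<bar> \<le> b"
  shows "(\<lambda>N. empirical_mean w N f) \<longlonglongrightarrow> expectation (\<lambda>x. f (W x))"
proof -
  have meas: "f \<in> borel_measurable borel"
    using cont by (intro borel_measurable_continuous_onI continuous_at_imp_continuous_on) auto
  have "real_distribution (weight_law w N)" for N
    unfolding weight_law_def by (intro prob_space.real_distribution_distr prob_space_measure_pmf) auto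
  moreover have "real_distribution (distr P borel W)" by simp
  moreover have "weak_conv_m (weight_law w) (distr P borel W)"
    using regular by (simp add: weight_regularity_def)
  ultimately have "(\<lambda>N. integral\<^sup>L (weight_law w N) f) \<longlonglongrightarrow> integral\<^sup>L (distr P borel W) f"
    by (rule weak_conv_imp_integral_bdd_continuous_conv) (use cont bdd in auto)
  moreover have "integral\<^sup>L (distr P borel W) f = expectation (\<lambda>x. f (W x))"
    using meas by (intro integral_distr) auto
  moreover have "\<forall>\<^sub>F N in sequentially. integral\<^sup>L (weight_law w N) f = empirical_mean w N f"
    using eventually_ge_at_top[of 1] by eventually_elim (rule integral_weight_law[OF meas])
  ultimately show ?thesis using tendsto_cong by force
qed

text \<open>
  Positivity of the weights passes to the weak limit by testing against the bounded continuous function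
  \<open>min 1 (max 0 (- x))\<close>, which charges exactly the negative half-line.
\<close>

lemma W_nonneg: "AE x in P. 0 \<le> W x"
proof -
  let ?f = "\<lambda>x::real. min 1 (max 0 (- x))"
  have "(\<lambda>N. empirical_mean w N ?f) \<longlonglongrightarrow> expectation (\<lambda>x. ?f (W x))"
    by (rule empirical_mean_tendsto_bounded[where b = 1]) (auto intro!: continuous_intros)
  moreover have "empirical_mean w N ?f = 0" for N
  proof -
    have "(\<Sum>i\<in>{1..N}. ?f (w N i)) = (\<Sum>i\<in>{1..N}. 0)"
      using w_pos by (intro sum.cong refl) (auto simp: less_imp_le)
    then show ?thesis unfolding empirical_mean_def by simp
  qed
  ultimately have "expectation (\<lambda>x. ?f (W x)) = 0" by (simp add: LIMSEQ_const_iff)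
  moreover have "integrable P (\<lambda>x. ?f (W x))" by (rule integrable_const_bound[where B = 1]) auto
  ultimately have "AE x in P. ?f (W x) = 0" by (subst integral_nonneg_eq_0_iff_AE[symmetric]) auto
  then show ?thesis by eventually_elim (auto simp: min_def max_def split: if_splits)
qed

lemma truncate_int [simp]: "integrable P (\<lambda>x. truncate k (W x))"
  by (rule Bochner_Integration.integrable_bound[OF W_int]) (auto simp: truncate_def)

lemma truncated_mean_tendsto: "(\<lambda>n. expectation (\<lambda>x. truncate (real n) (W x))) \<longlonglongrightarrow> expectation W"
proof (rule integral_dominated_convergence[where w = "\<lambda>x. \<bar>W x\<bar>"])
  show "AE x in P. (\<lambda>n. truncate (real n) (W x)) \<longlonglongrightarrow> W x"
    using W_nonneg
  proof eventually_elim
    case (elim x)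
    have "\<forall>\<^sub>F n in sequentially. truncate (real n) (W x) = W x"
      using eventually_ge_at_top[of "nat \<lceil>W x\<rceil>"]
      by eventually_elim (use elim in \<open>simp add: truncate_def\<close>)
    then show ?case by (rule tendsto_eventually)
  qed
qed (auto simp: truncate_def)

lemma truncation_error_small:
  assumes "0 < e"
  obtains k where "0 \<le> k" "expectation W - expectation (\<lambda>x. truncate k (W x)) < e"
proof -
  have "\<forall>\<^sub>F n in sequentially. expectation W - e < expectation (\<lambda>x. truncate (real n) (W x))"
    using truncated_mean_tendsto by (rule order_tendstoD) (use assms in simp)
  then obtain n where "expectation W - e < expectation (\<lambda>x. truncate (real n) (W x))"
    by (auto simp: eventually_sequentially)
  then show thesis by (intro that[of "real n"]) auto
qed

lemma isCont_truncate: "isCont (truncate k) x"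
  unfolding truncate_def by (intro continuous_intros)

text \<open>
  Weak convergence handles the truncated weights and convergence of the means handles the untruncated ones; together they
  control the mass that truncation removes, uniformly in large \<open>N\<close>. This serves as uniform integrability.
\<close>

lemma truncated_excess_tendsto:
  assumes "0 \<le> k"
  shows "(\<lambda>N. empirical_mean w N (\<lambda>x. x - truncate k x))
    \<longlonglongrightarrow> expectation W - expectation (\<lambda>x. truncate k (W x))"
proof -
  have "(\<lambda>N. empirical_mean w N (truncate k)) \<longlonglongrightarrow> expectation (\<lambda>x. truncate k (W x))"
    by (rule empirical_mean_tendsto_bounded[where b = k]) (use assms isCont_truncate in \<open>auto simp: truncate_def\<close>)
  from tendsto_diff[OF mean_weight_tendsto this] show ?thesis
    by (simp add: empirical_mean_def total_weight_def sum_subtractf diff_divide_distrib)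
qed

text \<open>
  Weak convergence alone covers bounded functions only. Truncating the argument changes a Lipschitz function by at most a
  multiple of the truncated excess, whose mean is small both along the sequence and in the limit.
\<close>

lemma empirical_mean_tendsto_Lipschitz:
  assumes cont: "\<And>x. isCont f x" and Lip: "\<And>x y. \<bar>f x - f y\<bar> \<le> L * \<bar>x - y\<bar>"
  shows "(\<lambda>N. empirical_mean w N f) \<longlonglongrightarrow> expectation (\<lambda>x. f (W x))"
proof -
  have L: "0 \<le> L" using Lip[of 0 1] by simp
  have meas [measurable]: "f \<in> borel_measurable borel"
    using cont by (intro borel_measurable_continuous_onI continuous_at_imp_continuous_on) auto
  have f_bound: "\<bar>f y\<bar> \<le> \<bar>f 0\<bar> + L * \<bar>y\<bar>" for y using Lip[of y 0] by simp
  have f_int: "integrable P (\<lambda>x. f (g x))" if [simp]: "integrable P g" for g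
  proof (rule Bochner_Integration.integrable_bound[where f = "\<lambda>x. \<bar>f 0\<bar> + L * \<bar>g x\<bar>"])
    have [measurable]: "g \<in> borel_measurable P" using that by (rule borel_measurable_integrable)
    show "(\<lambda>x. f (g x)) \<in> borel_measurable P" by measurable
    show "AE x in P. norm (f (g x)) \<le> norm (\<bar>f 0\<bar> + L * \<bar>g x\<bar>)"
      using f_bound L by (intro AE_I2) (simp add: order_trans[OF _ abs_ge_self])
  qed (auto intro!: Bochner_Integration.integrable_add)
  show ?thesis
  proof (rule LIMSEQ_I)
    fix e :: real assume e: "0 < e"
    obtain k where k: "0 \<le> k" "expectation W - expectation (\<lambda>x. truncate k (W x)) < e / (2 * (L + 1))"
      using truncation_error_small[of "e / (2 * (L + 1))"] e L by auto
    define d where "d = expectation W - expectation (\<lambda>x. truncate k (W x))"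
    define g where "g = (\<lambda>N. L * empirical_mean w N (\<lambda>x. x - truncate k x)
      + \<bar>empirical_mean w N (\<lambda>x. f (truncate k x)) - expectation (\<lambda>x. f (truncate k (W x)))\<bar> + L * d)"
    have "0 \<le> d"
    proof -
      have "expectation (\<lambda>x. truncate k (W x)) \<le> expectation W"
        using W_nonneg by (intro integral_mono_AE) (auto simp: truncate_def)
      then show ?thesis by (simp add: d_def)
    qed
    have "d * (2 * (L + 1)) < e" using k L by (simp add: d_def field_simps)
    then have d: "2 * (L * d) < e" using \<open>0 \<le> d\<close> by (simp add: algebra_simps)
    have bd: "\<bar>f (truncate k x)\<bar> \<le> \<bar>f 0\<bar> + L * k" for x
    proof -
      have "\<bar>truncate k x\<bar> \<le> k" using k by (auto simp: truncate_def)
      with f_bound[of "truncate k x"] mult_left_mono[OF this L] show ?thesis by linarith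
    qed
    have "(\<lambda>N. empirical_mean w N (\<lambda>x. f (truncate k x))) \<longlonglongrightarrow> expectation (\<lambda>x. f (truncate k (W x)))"
      by (rule empirical_mean_tendsto_bounded[OF _ bd]) (intro isCont_o2[OF isCont_truncate] cont)
    then have "(\<lambda>N. \<bar>empirical_mean w N (\<lambda>x. f (truncate k x)) - expectation (\<lambda>x. f (truncate k (W x)))\<bar>)
        \<longlonglongrightarrow> 0"
      by (intro tendsto_rabs_zero) (simp add: LIM_zero)
    then have "g \<longlonglongrightarrow> L * d + 0 + L * d"
      unfolding g_def d_def by (intro tendsto_add tendsto_mult tendsto_const truncated_excess_tendsto k(1))
    then have "\<forall>\<^sub>F N in sequentially. g N < e"
      by (rule order_tendstoD(2)) (use d in simp)
    moreover have "norm (empirical_mean w N f - expectation (\<lambda>x. f (W x))) \<le> g N" for N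
    proof -
      have "\<bar>empirical_mean w N f - empirical_mean w N (\<lambda>x. f (truncate k x))\<bar>
          \<le> L * empirical_mean w N (\<lambda>x. x - truncate k x)"
      proof -
        have "\<bar>(\<Sum>i\<in>{1..N}. f (w N i)) - (\<Sum>i\<in>{1..N}. f (truncate k (w N i)))\<bar>
            \<le> (\<Sum>i\<in>{1..N}. \<bar>f (w N i) - f (truncate k (w N i))\<bar>)"
          unfolding sum_subtractf[symmetric] by (rule sum_abs)
        also have "\<dots> \<le> (\<Sum>i\<in>{1..N}. L * (w N i - truncate k (w N i)))"
        proof (rule sum_mono)
          fix i assume "i \<in> {1..N}"
          then have "truncate k (w N i) \<le> w N i" using w_pos[of i N] by (auto simp: truncate_def)
          with Lip[of "w N i" "truncate k (w N i)"]
          show "\<bar>f (w N i) - f (truncate k (w N i))\<bar> \<le> L * (w N i - truncate k (w N i))" by simp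
        qed
        also have "\<dots> = L * (\<Sum>i\<in>{1..N}. w N i - truncate k (w N i))" by (simp only: sum_distrib_left)
        finally show ?thesis
          unfolding empirical_mean_def diff_divide_distrib[symmetric] abs_divide times_divide_eq_right
          by (simp add: divide_right_mono)
      qed
      moreover have "\<bar>expectation (\<lambda>x. f (truncate k (W x))) - expectation (\<lambda>x. f (W x))\<bar> \<le> L * d"
      proof -
        have "\<bar>expectation (\<lambda>x. f (truncate k (W x))) - expectation (\<lambda>x. f (W x))\<bar>
            = \<bar>expectation (\<lambda>x. f (truncate k (W x)) - f (W x))\<bar>"
          by (subst Bochner_Integration.integral_diff) (auto intro!: f_int)
        also have "\<dots> \<le> expectation (\<lambda>x. \<bar>f (truncate k (W x)) - f (W x)\<bar>)"
          using integral_norm_bound[of P "\<lambda>x. f (truncate k (W x)) - f (W x)"] by simp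
        also have "\<dots> \<le> expectation (\<lambda>x. L * (W x - truncate k (W x)))"
        proof (rule integral_mono_AE)
          show "AE x in P. \<bar>f (truncate k (W x)) - f (W x)\<bar> \<le> L * (W x - truncate k (W x))"
            using W_nonneg
          proof eventually_elim
            case (elim x)
            then have "truncate k (W x) \<le> W x" by (auto simp: truncate_def)
            with Lip[of "truncate k (W x)" "W x"] show ?case by simp
          qed
          show "integrable P (\<lambda>x. \<bar>f (truncate k (W x)) - f (W x)\<bar>)"
            by (intro integrable_abs Bochner_Integration.integrable_diff f_int truncate_int W_int)
        qed simp
        also have "\<dots> = L * d" by (simp add: d_def)
        finally show ?thesis .
      qed
      ultimately show ?thesis unfolding g_def real_norm_def by linarith
    qed
    ultimately have "\<forall>\<^sub>F N in sequentially. norm (empirical_mean w N f - expectation (\<lambda>x. f (W x))) < e"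
      by (auto elim!: eventually_mono intro: le_less_trans)
    then show "\<exists>no. \<forall>n\<ge>no. norm (empirical_mean w n f - expectation (\<lambda>x. f (W x))) < e"
      by (simp add: eventually_sequentially)
  qed
qed

text \<open>
  If both weights are at most \<open>2 k\<close>, then \<open>q \<le> 4 k\<^sup>2 / l\<close> with \<open>l\<close> the total weight. Otherwise one weight \<open>x\<close> exceeds
  \<open>2 k\<close> and is at most twice its excess \<open>x - truncate k x\<close>. Summed over the other endpoint, \<open>q\<close> gives back
  the weight of a vertex.
\<close>

lemma intensity_error_bound:
  assumes N: "1 \<le> N" and k: "0 \<le> k"
  shows "intensity_error w N / real N \<le> 4 * k\<^sup>2 / real N + 4 * empirical_mean w N (\<lambda>x. x - truncate k x)"
proof -
  define l where "l = total_weight w N"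
  define D where "D = (\<lambda>i. w N i - truncate k (w N i))"
  have l: "0 < l" unfolding l_def using w_pos N by (intro total_weight_pos) auto
  have sumw: "(\<Sum>i\<in>{1..N}. w N i) = l" by (simp add: l_def total_weight_def)
  have edge: "edge_intensity w N i j * min 1 (edge_intensity w N i j)
      \<le> 4 * k\<^sup>2 / l\<^sup>2 * (w N i * w N j) + 2 / l * (D i * w N j) + 2 / l * (w N i * D j)"
    if ij: "i \<in> {1..N}" "j \<in> {1..N}" for i j
  proof -
    have wp: "0 < w N i" "0 < w N j" using ij w_pos by auto
    have D0: "0 \<le> D i" "0 \<le> D j" using wp by (auto simp: D_def truncate_def)
    have q: "0 \<le> edge_intensity w N i j" using wp l by (simp add: edge_intensity_def l_def)
    have large: "x / 2 \<le> x - truncate k x" if "2 * k < x" for x using that k by (auto simp: truncate_def)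
    have nn: "0 \<le> 4 * k\<^sup>2 / l\<^sup>2 * (w N i * w N j)" "0 \<le> 2 / l * (D i * w N j)" "0 \<le> 2 / l * (w N i * D j)"
      using wp D0 l by auto
    have qle: "edge_intensity w N i j * min 1 (edge_intensity w N i j) \<le> w N i * w N j / l"
      using mult_left_mono[OF min.cobounded1 q, of 1] by (simp add: edge_intensity_def l_def)
    consider "2 * k < w N i" | "2 * k < w N j" | "w N i \<le> 2 * k" "w N j \<le> 2 * k" by linarith
    then show ?thesis
    proof cases
      case 1
      have "2 / l * ((w N i / 2) * w N j) \<le> 2 / l * (D i * w N j)"
        using large[OF 1] wp l unfolding D_def by (intro mult_left_mono mult_right_mono) auto
      with nn qle show ?thesis by simp
    next
      case 2
      have "2 / l * (w N i * (w N j / 2)) \<le> 2 / l * (w N i * D j)"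
        using large[OF 2] wp l unfolding D_def by (intro mult_left_mono) auto
      with nn qle show ?thesis by simp
    next
      case 3
      have "w N i * w N j \<le> (2 * k) * (2 * k)" using 3 wp k by (intro mult_mono) auto
      then have "w N i * w N j * (w N i * w N j) \<le> (2 * k) * (2 * k) * (w N i * w N j)"
        using wp by (intro mult_right_mono) auto
      then have "(w N i * w N j / l) * (w N i * w N j / l) \<le> 4 * k\<^sup>2 / l\<^sup>2 * (w N i * w N j)"
        using l by (simp add: power2_eq_square divide_right_mono)
      moreover have "edge_intensity w N i j * min 1 (edge_intensity w N i j) \<le> edge_intensity w N i j * edge_intensity w N i j"
        using q by (intro mult_left_mono) auto
      ultimately show ?thesis using nn by (simp add: edge_intensity_def l_def)
    qed
  qed
  have "intensity_error w N
      \<le> (\<Sum>i\<in>{1..N}. \<Sum>j\<in>{1..N}. 4 * k\<^sup>2 / l\<^sup>2 * (w N i * w N j) + 2 / l * (D i * w N j) + 2 / l * (w N i * D j))"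
    unfolding intensity_error_def using edge by (intro sum_mono) auto
  also have "\<dots> = 4 * k\<^sup>2 / l\<^sup>2 * (l * l) + 2 / l * ((\<Sum>i\<in>{1..N}. D i) * l) + 2 / l * (l * (\<Sum>j\<in>{1..N}. D j))"
    by (simp only: sum.distrib sum_distrib_left[symmetric] sum_distrib_right[symmetric] sumw)
  also have "\<dots> = 4 * k\<^sup>2 + 4 * (\<Sum>i\<in>{1..N}. D i)" using l by (simp add: power2_eq_square)
  finally have "intensity_error w N / real N \<le> (4 * k\<^sup>2 + 4 * (\<Sum>i\<in>{1..N}. D i)) / real N"
    by (rule divide_right_mono) simp
  then show ?thesis by (simp add: empirical_mean_def D_def add_divide_distrib)
qed

lemma intensity_error_negligible: "(\<lambda>N. intensity_error w N / real N) \<longlonglongrightarrow> 0"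
proof (rule LIMSEQ_I)
  fix e :: real assume e: "0 < e"
  obtain k where k: "0 \<le> k" "expectation W - expectation (\<lambda>x. truncate k (W x)) < e / 4"
    using truncation_error_small[of "e / 4"] e by auto
  have "(\<lambda>N. 4 * k\<^sup>2 / real N + 4 * empirical_mean w N (\<lambda>x. x - truncate k x))
      \<longlonglongrightarrow> 0 + 4 * (expectation W - expectation (\<lambda>x. truncate k (W x)))"
    by (intro tendsto_add tendsto_mult tendsto_const truncated_excess_tendsto k(1)
        tendsto_divide_0[OF tendsto_const] filterlim_real_sequentially
        filterlim_at_top_imp_at_infinity)
  then have "\<forall>\<^sub>F N in sequentially. 4 * k\<^sup>2 / real N + 4 * empirical_mean w N (\<lambda>x. x - truncate k x) < e"
    by (rule order_tendstoD(2)) (use k in simp)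
  then have "\<forall>\<^sub>F N in sequentially. norm (intensity_error w N / real N - 0) < e"
    using eventually_ge_at_top[of 1]
  proof eventually_elim
    case (elim N)
    have "0 \<le> intensity_error w N"
      unfolding intensity_error_def using w_pos elim
      by (intro sum_nonneg mult_nonneg_nonneg) (auto intro!: edge_intensity_nonneg)
    then show ?case using intensity_error_bound[OF elim(2) k(1)] elim by simp
  qed
  then show "\<exists>no. \<forall>N\<ge>no. norm (intensity_error w N / real N - 0) < e"
    by (simp add: eventually_sequentially)
qed

lemma coupling_tendsto: "coupling w \<beta> \<longlonglongrightarrow> sqrt (sinh \<beta> / expectation W)"
  unfolding coupling_def using W_mean_pos
  by (intro tendsto_real_sqrt tendsto_divide mean_weight_tendsto) auto

lemma empirical_free_energy_tendsto:
  "(\<lambda>N. empirical_free_energy w \<beta> N B u) \<longlonglongrightarrow>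
     expectation (\<lambda>x. ln (cosh (B + sqrt (sinh \<beta> / expectation W) * u * W x))) - u\<^sup>2 / 2"
proof -
  define r where "r = sqrt (sinh \<beta> / expectation W)"
  let ?f = "\<lambda>r x. ln (cosh (B + r * u * x))"
  have "(\<lambda>N. empirical_mean w N (?f r)) \<longlonglongrightarrow> expectation (\<lambda>x. ?f r (W x))"
  proof (rule empirical_mean_tendsto_Lipschitz[where L = "\<bar>r * u\<bar>"])
    show "isCont (?f r) x" for x
      by (intro continuous_intros) (use cosh_real_pos[of "B + r * u * x"] in linarith)
    show "\<bar>?f r x - ?f r y\<bar> \<le> \<bar>r * u\<bar> * \<bar>x - y\<bar>" for x y
      using ln_cosh_Lipschitz[of "B + r * u * x" "B + r * u * y"]
      by (simp flip: abs_mult) (simp add: algebra_simps)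
  qed
  moreover have "(\<lambda>N. empirical_mean w N (?f (coupling w \<beta> N)) - empirical_mean w N (?f r)) \<longlonglongrightarrow> 0"
  proof (rule Lim_null_comparison)
    show "\<forall>\<^sub>F N in sequentially. norm (empirical_mean w N (?f (coupling w \<beta> N)) - empirical_mean w N (?f r))
        \<le> \<bar>coupling w \<beta> N - r\<bar> * \<bar>u\<bar> * (total_weight w N / real N)"
    proof (intro always_eventually allI)
      fix N
      have "\<bar>(\<Sum>i\<in>{1..N}. ?f (coupling w \<beta> N) (w N i)) - (\<Sum>i\<in>{1..N}. ?f r (w N i))\<bar>
          \<le> (\<Sum>i\<in>{1..N}. \<bar>?f (coupling w \<beta> N) (w N i) - ?f r (w N i)\<bar>)"
        unfolding sum_subtractf[symmetric] by (rule sum_abs)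
      also have "\<dots> \<le> (\<Sum>i\<in>{1..N}. \<bar>coupling w \<beta> N - r\<bar> * \<bar>u\<bar> * w N i)"
      proof (rule sum_mono)
        fix i assume "i \<in> {1..N}"
        then have "0 < w N i" using w_pos by auto
        have "(B + coupling w \<beta> N * u * w N i) - (B + r * u * w N i) = (coupling w \<beta> N - r) * u * w N i"
          by (simp add: algebra_simps)
        with ln_cosh_Lipschitz[of "B + coupling w \<beta> N * u * w N i" "B + r * u * w N i"] \<open>0 < w N i\<close>
        show "\<bar>?f (coupling w \<beta> N) (w N i) - ?f r (w N i)\<bar> \<le> \<bar>coupling w \<beta> N - r\<bar> * \<bar>u\<bar> * w N i"
          by (simp add: abs_mult)
      qed
      also have "\<dots> = \<bar>coupling w \<beta> N - r\<bar> * \<bar>u\<bar> * total_weight w N"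
        by (simp only: total_weight_def sum_distrib_left)
      finally show "norm (empirical_mean w N (?f (coupling w \<beta> N)) - empirical_mean w N (?f r))
        \<le> \<bar>coupling w \<beta> N - r\<bar> * \<bar>u\<bar> * (total_weight w N / real N)"
        unfolding empirical_mean_def diff_divide_distrib[symmetric] real_norm_def abs_divide times_divide_eq_right
        by (simp add: divide_right_mono)
    qed
    have "(\<lambda>N. \<bar>coupling w \<beta> N - r\<bar> * \<bar>u\<bar> * (total_weight w N / real N)) \<longlonglongrightarrow> \<bar>r - r\<bar> * \<bar>u\<bar> * expectation W"
      unfolding r_def by (intro tendsto_intros coupling_tendsto mean_weight_tendsto)
    then show "(\<lambda>N. \<bar>coupling w \<beta> N - r\<bar> * \<bar>u\<bar> * (total_weight w N / real N)) \<longlonglongrightarrow> 0" by simp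
  qed
  ultimately have "(\<lambda>N. empirical_mean w N (?f (coupling w \<beta> N))) \<longlonglongrightarrow> expectation (\<lambda>x. ?f r (W x))"
    using tendsto_add by fastforce
  then show ?thesis unfolding empirical_free_energy_def r_def by (intro tendsto_diff tendsto_const)
qed

lemma limiting_weight_coupling:
  assumes "0 \<le> \<beta>" shows "limiting_weight P W (sqrt (sinh \<beta> / expectation W))"
  using assms W_mean_pos W_nonneg W2_int by unfold_locales (auto simp: less_imp_le)

end

section \<open>Concentration of the total spin\<close>

context regular_weights
begin

text \<open>
  The hypothesis leaves a margin \<open>c\<close> in the exponent. Five error sources get a tenth of it each: the upper and the lower
  approximation of the free energy, the grid spacing, the grid size, and the comparison with the mean-field energy. Half of the
  margin remains.
\<close>

lemma annealed_tail_bound: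
  fixes \<beta> B F m t c :: real
  defines "r \<equiv> sqrt (sinh \<beta> / expectation W)"
  assumes \<beta>: "0 \<le> \<beta>" and c: "0 < c"
    and upper: "\<And>v. limiting_weight.free_energy P W r (B + t) v
      \<le> limiting_weight.free_energy P W r B u + (a - c)"
  shows "\<forall>\<^sub>F N in sequentially.
    measure (annealed_ising w \<beta> B N) {\<sigma> \<in> spin_configs N. t * total_spin N \<sigma> \<ge> real N * a}
    \<le> exp (- (real N * (c / 2)))"
proof -
  interpret limiting_weight P W r unfolding r_def by (rule limiting_weight_coupling[OF \<beta>])
  define F where "F = free_energy B u"
  have lim: "(\<lambda>N. empirical_free_energy w \<beta> N B' v) \<longlonglongrightarrow> free_energy B' v" for B' v
    unfolding free_energy_def unfolding r_def by (rule empirical_free_energy_tendsto)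
  define C where "C = r * expectation W + 1"
  have "(\<lambda>N. coupling w \<beta> N * (total_weight w N / real N)) \<longlonglongrightarrow> r * expectation W"
    unfolding r_def by (intro tendsto_mult coupling_tendsto mean_weight_tendsto)
  then have evC: "\<forall>\<^sub>F N in sequentially. coupling w \<beta> N * (total_weight w N / real N) < C"
    by (rule order_tendstoD(2)) (simp add: C_def)
  \<comment> \<open>grid spacing chosen so that its cost \<open>\<delta>\<^sup>2 / 2\<close> is \<open>c / 10\<close>\<close>
  define \<delta> where "\<delta> = sqrt (c / 5)"
  have \<delta>: "0 < \<delta>" "\<delta>\<^sup>2 / 2 = c / 10" using c by (simp_all add: \<delta>_def)
  obtain G where G: "finite G" "{-C..C} \<subseteq> (\<Union>u\<in>G. ball u \<delta>)"
    using compact_Icc[of "-C" C] \<delta>(1) unfolding compact_eq_totally_bounded by blast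
  have cover: "\<exists>u\<in>G. \<bar>y - u\<bar> \<le> \<delta>" if "\<bar>y\<bar> \<le> C" for y
  proof -
    have "y \<in> {-C..C}" using that by auto
    with G(2) obtain u where "u \<in> G" "dist u y < \<delta>" by (auto simp: subset_iff)
    then show ?thesis by (intro bexI[of _ u]) (auto simp: dist_real_def)
  qed
  have evG: "\<forall>\<^sub>F N in sequentially. \<forall>v\<in>G. empirical_free_energy w \<beta> N (B + t) v < F + (a - c) + c / 10"
  proof (intro eventually_ball_finite[OF G(1)] ballI order_tendstoD(2)[OF lim])
    show "free_energy (B + t) v < F + (a - c) + c / 10" for v
      using upper[of v] c by (simp add: F_def)
  qed
  have evF: "\<forall>\<^sub>F N in sequentially. F - c / 10 < empirical_free_energy w \<beta> N B u"
    by (intro order_tendstoD(1)[OF lim]) (use c in \<open>simp add: F_def\<close>)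
  have "(\<lambda>N. 4 * (exp \<beta>)\<^sup>2 * (intensity_error w N / real N)) \<longlonglongrightarrow> 4 * (exp \<beta>)\<^sup>2 * 0"
    by (intro tendsto_mult tendsto_const intensity_error_negligible)
  then have evE: "\<forall>\<^sub>F N in sequentially. 4 * (exp \<beta>)\<^sup>2 * (intensity_error w N / real N) < c / 10"
    by (rule order_tendstoD(2)) (use c in simp)
  have evcard: "\<forall>\<^sub>F N in sequentially. real (card G) \<le> exp (real N * (c / 10))"
    using c by real_asymp
  show ?thesis
    using evC evG evF evE evcard eventually_ge_at_top[of 1]
  proof eventually_elim
    case (elim N)
    note pos = w_pos[where N = N]
    note N = elim(6)
    define Z where "Z = (\<lambda>B. mean_field_partition w \<beta> B N)"
    have lower: "2 ^ N * exp (real N * (F - c / 10)) \<le> Z B"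
    proof -
      have "2 ^ N * exp (real N * (F - c / 10)) \<le> 2 ^ N * exp (real N * empirical_free_energy w \<beta> N B u)"
        using elim(3) by (auto intro!: mult_left_mono)
      also have "\<dots> \<le> Z B"
        unfolding Z_def by (rule mean_field_partition_lower[where w = w and N = N, OF pos N \<beta>])
      finally show ?thesis .
    qed
    have "Z (B + t) \<le> real (card G) * (2 ^ N * exp (real N * ((F + (a - c) + c / 10) + \<delta>\<^sup>2 / 2)))"
      unfolding Z_def
      by (rule mean_field_partition_upper[where w = w and N = N, OF pos N \<beta> G(1) cover])
         (use elim(1,2) in \<open>auto intro: less_imp_le\<close>)
    also have "\<dots> \<le> exp (real N * (c / 10)) * (2 ^ N * exp (real N * ((F + (a - c) + c / 10) + c / 10)))"
      unfolding \<delta>(2) by (intro mult_right_mono elim(5)) auto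
    also have "\<dots> = 2 ^ N * exp (real N * (F + a - 7 * c / 10))"
      by (simp add: exp_add[symmetric] field_simps)
    finally have "Z (B + t) / Z B
        \<le> (2 ^ N * exp (real N * (F + a - 7 * c / 10))) / (2 ^ N * exp (real N * (F - c / 10)))"
      using lower by (intro frac_le) auto
    also have "\<dots> = exp (real N * (a - 6 * c / 10))"
      by (simp add: exp_diff[symmetric] field_simps)
    finally have ratio: "Z (B + t) / Z B \<le> exp (real N * (a - 6 * c / 10))" .
    have "4 * (exp \<beta>)\<^sup>2 * intensity_error w N \<le> real N * (c / 10)"
      using elim(4) N by (simp add: field_simps)
    then have err: "exp (4 * (exp \<beta>)\<^sup>2 * intensity_error w N - real N * a) \<le> exp (real N * (c / 10) - real N * a)"
      by simp
    have "measure (annealed_ising w \<beta> B N) {\<sigma> \<in> spin_configs N. t * total_spin N \<sigma> \<ge> real N * a}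
        \<le> exp (4 * (exp \<beta>)\<^sup>2 * intensity_error w N - real N * a) * (Z (B + t) / Z B)"
      unfolding Z_def by (rule annealed_exponential_Chebyshev[where w = w and N = N, OF pos N \<beta>])
    also have "\<dots> \<le> exp (real N * (c / 10) - real N * a) * exp (real N * (a - 6 * c / 10))"
      by (intro mult_mono err ratio) (auto simp: Z_def intro!: divide_nonneg_nonneg sum_nonneg simp: mean_field_partition_def)
    also have "\<dots> = exp (- (real N * (c / 2)))"
      by (simp add: exp_add[symmetric] field_simps)
    finally show ?case .
  qed
qed

text \<open>
  The upper bound of \<open>envelope_upper_bound\<close> is applied with slack \<open>\<epsilon> / 2\<close> to a tilt \<open>t = \<tau>\<close> for the upper
  tail and \<open>t = - \<tau>\<close> for the lower tail; both have the form treated by \<open>annealed_tail_bound\<close>.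
\<close>

lemma annealed_concentration:
  fixes \<beta> B u \<epsilon> :: real
  defines "r \<equiv> sqrt (sinh \<beta> / expectation W)"
  assumes \<beta>: "0 \<le> \<beta>" and uniq: "limiting_weight.unique_maximizer P W r B u" and \<epsilon>: "0 < \<epsilon>"
  shows "\<exists>L>0. \<forall>\<^sub>F N in sequentially.
    measure (annealed_ising w \<beta> B N)
      {\<sigma> \<in> spin_configs N. \<bar>total_spin N \<sigma> / real N - limiting_weight.magnetization P W r B u\<bar> \<ge> \<epsilon>}
    \<le> exp (- (real N * L))"
proof -
  interpret limiting_weight P W r unfolding r_def by (rule limiting_weight_coupling[OF \<beta>])
  define m where "m = magnetization B u"
  obtain \<tau> where \<tau>: "0 < \<tau>" "\<And>t v. \<bar>t\<bar> \<le> \<tau> \<Longrightarrow>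
      free_energy (B + t) v \<le> free_energy B u + t * m + \<bar>t\<bar> * (\<epsilon> / 2)"
    using envelope_upper_bound[OF uniq, of "\<epsilon> / 2"] \<epsilon> unfolding m_def by auto
  define c where "c = \<tau> * \<epsilon> / 2"
  have c: "0 < c" using \<tau> \<epsilon> by (simp add: c_def)
  have tail: "\<forall>\<^sub>F N in sequentially.
      measure (annealed_ising w \<beta> B N) {\<sigma> \<in> spin_configs N. t * total_spin N \<sigma> \<ge> real N * (t * m + \<tau> * \<epsilon>)}
      \<le> exp (- (real N * (c / 2)))" if t: "\<bar>t\<bar> = \<tau>" for t
  proof (rule annealed_tail_bound[OF \<beta> c, folded r_def])
    show "free_energy (B + t) v \<le> free_energy B u + (t * m + \<tau> * \<epsilon> - c)" for v
      using \<tau>(2)[of t v] t by (simp add: c_def algebra_simps)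
  qed
  \<comment> \<open>absorbs the factor 2 from the union of the two tails\<close>
  have "\<forall>\<^sub>F N in sequentially. (2::real) \<le> exp (real N * (c / 4))" using c by real_asymp
  moreover have "\<bar>\<tau>\<bar> = \<tau>" "\<bar>- \<tau>\<bar> = \<tau>" using \<tau>(1) by auto
  note tail[OF this(1)] tail[OF this(2)] eventually_ge_at_top[of "1::nat"]
  ultimately
  have "\<forall>\<^sub>F N in sequentially. measure (annealed_ising w \<beta> B N)
      {\<sigma> \<in> spin_configs N. \<bar>total_spin N \<sigma> / real N - m\<bar> \<ge> \<epsilon>} \<le> exp (- (real N * (c / 4)))"
  proof eventually_elim
    case (elim N)
    let ?\<mu> = "annealed_ising w \<beta> B N"
    let ?U = "\<lambda>t. {\<sigma> \<in> spin_configs N. t * total_spin N \<sigma> \<ge> real N * (t * m + \<tau> * \<epsilon>)}"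
    have sets: "A \<in> sets ?\<mu>" if "A \<subseteq> spin_configs N" for A
      using that unfolding annealed_ising_def by (simp add: sets_point_measure)
    interpret \<mu>: prob_space ?\<mu> by (rule prob_space_annealed_ising)
    have sub: "{\<sigma> \<in> spin_configs N. \<bar>total_spin N \<sigma> / real N - m\<bar> \<ge> \<epsilon>} \<subseteq> ?U \<tau> \<union> ?U (- \<tau>)"
    proof safe
      fix \<sigma> assume \<sigma>: "\<bar>total_spin N \<sigma> / real N - m\<bar> \<ge> \<epsilon>"
        and not: "\<not> real N * (- \<tau> * m + \<tau> * \<epsilon>) \<le> - \<tau> * total_spin N \<sigma>"
      have N: "0 < real N" using elim by simp
      have "\<not> total_spin N \<sigma> / real N - m \<le> - \<epsilon>"
      proof
        assume "total_spin N \<sigma> / real N - m \<le> - \<epsilon>"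
        then have "total_spin N \<sigma> \<le> real N * (m - \<epsilon>)" using N by (simp add: field_simps)
        then have "\<tau> * total_spin N \<sigma> \<le> \<tau> * (real N * (m - \<epsilon>))" using \<tau>(1) by simp
        with not show False by (simp add: algebra_simps)
      qed
      with \<sigma> have "m + \<epsilon> \<le> total_spin N \<sigma> / real N" by linarith
      then have "real N * (m + \<epsilon>) \<le> total_spin N \<sigma>" using N by (simp add: field_simps)
      then have "\<tau> * (real N * (m + \<epsilon>)) \<le> \<tau> * total_spin N \<sigma>" using \<tau>(1) by simp
      then show "real N * (\<tau> * m + \<tau> * \<epsilon>) \<le> \<tau> * total_spin N \<sigma>" by (simp add: algebra_simps)
    qed
    have "measure ?\<mu> {\<sigma> \<in> spin_configs N. \<bar>total_spin N \<sigma> / real N - m\<bar> \<ge> \<epsilon>} \<le> measure ?\<mu> (?U \<tau> \<union> ?U (- \<tau>))"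
      by (intro \<mu>.finite_measure_mono sub sets) auto
    also have "\<dots> \<le> measure ?\<mu> (?U \<tau>) + measure ?\<mu> (?U (- \<tau>))"
      by (intro measure_Un_le sets) auto
    also have "\<dots> \<le> 2 * exp (- (real N * (c / 2)))" using elim by simp
    also have "\<dots> \<le> exp (real N * (c / 4)) * exp (- (real N * (c / 2)))"
      using elim by (intro mult_right_mono) auto
    also have "\<dots> = exp (- (real N * (c / 4)))" by (simp add: exp_add[symmetric] field_simps)
    finally show ?case .
  qed
  with c show ?thesis unfolding m_def by (intro exI[of _ "c / 4"]) simp
qed

text \<open>
  The spin per vertex is bounded by 1, so concentration in probability implies convergence of the mean. This identifies the
  limit in the definition of the annealed magnetization and shows that it exists.
\<close>

lemma annealed_mean_spin_tendsto:
  assumes m: "\<bar>m\<bar> \<le> 1"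
    and conc: "\<And>\<epsilon>. 0 < \<epsilon> \<Longrightarrow> \<exists>L>0. \<forall>\<^sub>F N in sequentially. measure (annealed_ising w \<beta> B N)
      {\<sigma> \<in> spin_configs N. \<bar>total_spin N \<sigma> / real N - m\<bar> \<ge> \<epsilon>} \<le> exp (- (real N * L))"
  shows "(\<lambda>N. integral\<^sup>L (annealed_ising w \<beta> B N) (\<lambda>\<sigma>. total_spin N \<sigma> / real N)) \<longlonglongrightarrow> m"
proof (rule LIMSEQ_I)
  fix e :: real assume e: "0 < e"
  obtain L where L: "0 < L" "\<forall>\<^sub>F N in sequentially. measure (annealed_ising w \<beta> B N)
      {\<sigma> \<in> spin_configs N. \<bar>total_spin N \<sigma> / real N - m\<bar> \<ge> e / 2} \<le> exp (- (real N * L))"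
    using conc[of "e / 2"] e by auto
  have "\<forall>\<^sub>F N in sequentially. 2 * exp (- (real N * L)) < e / 2" using L(1) e by real_asymp
  with L(2) eventually_ge_at_top[of 1]
  have "\<forall>\<^sub>F N in sequentially. norm (integral\<^sup>L (annealed_ising w \<beta> B N) (\<lambda>\<sigma>. total_spin N \<sigma> / real N) - m) < e"
  proof eventually_elim
    case (elim N)
    let ?p = "annealed_weight w \<beta> B N" and ?S = "spin_configs N"
    let ?x = "\<lambda>\<sigma>. total_spin N \<sigma> / real N"
    let ?A = "{\<sigma> \<in> ?S. \<bar>?x \<sigma> - m\<bar> \<ge> e / 2}"
    have p: "0 \<le> ?p \<sigma>" for \<sigma> by (rule less_imp_le[OF annealed_weight_pos])
    have measA: "measure (annealed_ising w \<beta> B N) ?A = (\<Sum>\<sigma>\<in>?A. ?p \<sigma>)"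
      by (rule measure_annealed_ising) auto
    have "integral\<^sup>L (annealed_ising w \<beta> B N) ?x = (\<Sum>\<sigma>\<in>?S. ?p \<sigma> * ?x \<sigma>)"
      unfolding annealed_ising_def
      by (subst lebesgue_integral_point_measure_finite[OF finite_spin_configs]) (auto simp: p)
    then have "integral\<^sup>L (annealed_ising w \<beta> B N) ?x - m = (\<Sum>\<sigma>\<in>?S. ?p \<sigma> * (?x \<sigma> - m))"
      using sum_annealed_weight[of w \<beta> B N]
      by (simp add: right_diff_distrib sum_subtractf sum_distrib_right[symmetric])
    also have "\<bar>\<dots>\<bar> \<le> (\<Sum>\<sigma>\<in>?S. \<bar>?p \<sigma> * (?x \<sigma> - m)\<bar>)" by (rule sum_abs)
    also have "\<dots> \<le> (\<Sum>\<sigma>\<in>?S. e / 2 * ?p \<sigma> + (if \<bar>?x \<sigma> - m\<bar> \<ge> e / 2 then 2 * ?p \<sigma> else 0))"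
    proof (rule sum_mono)
      fix \<sigma> assume \<sigma>: "\<sigma> \<in> ?S"
      have "\<bar>total_spin N \<sigma>\<bar> \<le> (\<Sum>i\<in>{1..N}. \<bar>\<sigma> i\<bar>)" unfolding total_spin_def by (rule sum_abs)
      also have "\<dots> = (\<Sum>i\<in>{1..N}. 1)" using spin_cases[OF \<sigma>] by (intro sum.cong) fastforce+
      finally have "\<bar>?x \<sigma>\<bar> \<le> 1" using elim by (simp add: abs_divide)
      with m have "\<bar>?x \<sigma> - m\<bar> \<le> 2" by linarith
      then have "\<bar>?x \<sigma> - m\<bar> \<le> e / 2 + (if \<bar>?x \<sigma> - m\<bar> \<ge> e / 2 then 2 else 0)" using e by auto
      then have "\<bar>?p \<sigma> * (?x \<sigma> - m)\<bar> \<le> ?p \<sigma> * (e / 2 + (if \<bar>?x \<sigma> - m\<bar> \<ge> e / 2 then 2 else 0))"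
        unfolding abs_mult abs_of_nonneg[OF p] by (rule mult_left_mono[OF _ p])
      also have "\<dots> = e / 2 * ?p \<sigma> + (if \<bar>?x \<sigma> - m\<bar> \<ge> e / 2 then 2 * ?p \<sigma> else 0)"
        by (simp add: algebra_simps)
      finally show "\<bar>?p \<sigma> * (?x \<sigma> - m)\<bar> \<le> e / 2 * ?p \<sigma> + (if \<bar>?x \<sigma> - m\<bar> \<ge> e / 2 then 2 * ?p \<sigma> else 0)" .
    qed
    also have "\<dots> = e / 2 * (\<Sum>\<sigma>\<in>?S. ?p \<sigma>) + 2 * (\<Sum>\<sigma>\<in>?A. ?p \<sigma>)"
      unfolding sum.distrib sum_distrib_left
      by (simp add: sum.inter_filter[OF finite_spin_configs])
    also have "\<dots> \<le> e / 2 + 2 * exp (- (real N * L))"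
      using elim(1) measA sum_annealed_weight[of w \<beta> B N] by simp
    also have "\<dots> < e" using elim by simp
    finally show ?case by simp
  qed
  then show "\<exists>no. \<forall>N\<ge>no. norm (integral\<^sup>L (annealed_ising w \<beta> B N) (\<lambda>\<sigma>. total_spin N \<sigma> / real N) - m) < e"
    by (simp add: eventually_sequentially)
qed

lemma annealed_magnetization_eq:
  fixes \<beta> B u :: real
  defines "r \<equiv> sqrt (sinh \<beta> / expectation W)"
  assumes \<beta>: "0 \<le> \<beta>" and uniq: "limiting_weight.unique_maximizer P W r B u"
  shows "annealed_magnetization w \<beta> B = limiting_weight.magnetization P W r B u"
proof -
  interpret limiting_weight P W r unfolding r_def by (rule limiting_weight_coupling[OF \<beta>])
  have "(\<lambda>N. integral\<^sup>L (annealed_ising w \<beta> B N) (\<lambda>\<sigma>. total_spin N \<sigma> / real N)) \<longlonglongrightarrow> magnetization B u"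
    by (rule annealed_mean_spin_tendsto[OF magnetization_bound])
       (rule annealed_concentration[OF \<beta>, folded r_def, OF uniq])
  then show ?thesis unfolding annealed_magnetization_def by (rule limI)
qed

lemma coupling_square: "0 \<le> \<beta> \<Longrightarrow> (sqrt (sinh \<beta> / expectation W))\<^sup>2 = sinh \<beta> / expectation W"
  using W_mean_pos by (simp add: less_imp_le)

text \<open>
  For \<open>B > 0\<close> the annealed magnetization is monotone in \<open>B\<close> and bounded below by a positive constant, so its limit at
  \<open>0\<close> from the right exists and is positive.
\<close>

lemma spontaneous_magnetization:
  fixes \<beta> :: real
  assumes \<beta>: "0 < \<beta>" and super: "expectation W < sinh \<beta> * expectation (\<lambda>x. (W x)\<^sup>2)"
  shows "\<exists>m>0. (annealed_magnetization w \<beta> \<longlongrightarrow> m) (at_right 0)"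
proof -
  define r where "r = sqrt (sinh \<beta> / expectation W)"
  interpret limiting_weight P W r unfolding r_def by (rule limiting_weight_coupling) (use \<beta> in simp)
  have "1 < r\<^sup>2 * expectation (\<lambda>x. (W x)\<^sup>2)"
    using super W_mean_pos \<beta> by (simp add: r_def coupling_square)
  then obtain m0 where m0: "0 < m0" "\<And>B u. 0 < B \<Longrightarrow> maximizer B u \<Longrightarrow> m0 \<le> magnetization B u"
    using magnetization_bounded_below by blast
  have rep: "\<exists>u. maximizer B u \<and> annealed_magnetization w \<beta> B = magnetization B u" if B: "0 < B" for B
  proof -
    obtain u where u: "unique_maximizer B u" using unique_maximizer_pos_field[OF B] by blast
    have "annealed_magnetization w \<beta> B = magnetization B u"
      using annealed_magnetization_eq[of \<beta> B u, folded r_def] \<beta> u by simp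
    with u show ?thesis by (auto simp: unique_maximizer_def)
  qed
  let ?M = "annealed_magnetization w \<beta>"
  have low: "m0 \<le> ?M B" if "0 < B" for B using rep[OF that] m0(2)[OF that] by auto
  have "(?M \<longlongrightarrow> Inf (?M ` ({0<..} \<inter> UNIV))) (at 0 within ({0<..} \<inter> UNIV))"
  proof (rule Lim_right_bound)
    show "?M B \<le> ?M B'" if "0 < B" "B \<le> B'" for B B'
    proof (cases "B = B'")
      case False
      with that rep[of B] rep[of B'] magnetization_mono_field[of B _ B'] show ?thesis by fastforce
    qed simp
    show "m0 \<le> ?M B" if "0 < B" for B using low[OF that] .
  qed
  moreover have "m0 \<le> Inf (?M ` ({0<..} \<inter> UNIV))"
    using low by (intro cInf_greatest) auto
  ultimately show ?thesis using m0(1) by (intro exI[of _ "Inf (?M ` ({0<..} \<inter> UNIV))"]) auto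
qed

text \<open>
  An inverse temperature \<open>\<beta>'\<close> strictly between \<open>\<beta>\<close> and the critical one cannot be supercritical, since it would
  then belong to the set whose infimum is the critical value. This gives the weak inequality at \<open>\<beta>'\<close>, hence the strict
  one at \<open>\<beta>\<close>.
\<close>

lemma subcritical_coupling:
  assumes \<beta>: "0 < \<beta>" "\<beta> < annealed_beta_c w"
  shows "sinh \<beta> * expectation (\<lambda>x. (W x)\<^sup>2) < expectation W"
proof -
  let ?V = "expectation (\<lambda>x. (W x)\<^sup>2)"
  let ?S = "{\<beta>. \<beta> > 0 \<and> (\<exists>m>0. (annealed_magnetization w \<beta> \<longlongrightarrow> m) (at_right 0))}"
  obtain \<beta>' where \<beta>': "\<beta> < \<beta>'" "\<beta>' < annealed_beta_c w" using dense[OF \<beta>(2)] by blast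
  have V: "0 \<le> ?V" by simp
  have "sinh \<beta>' * ?V \<le> expectation W"
  proof (rule ccontr)
    assume "\<not> sinh \<beta>' * ?V \<le> expectation W"
    then have "\<beta>' \<in> ?S" using spontaneous_magnetization[of \<beta>'] \<beta> \<beta>' by auto
    then have "annealed_beta_c w \<le> \<beta>'"
      unfolding annealed_beta_c_def by (intro cInf_lower bdd_belowI[of _ 0]) auto
    with \<beta>'(2) show False by simp
  qed
  moreover have "sinh \<beta> < sinh \<beta>'" using \<beta>' by simp
  moreover have "sinh \<beta> * ?V < sinh \<beta>' * ?V \<or> ?V = 0" 
    using V mult_strict_right_mono[OF \<open>sinh \<beta> < sinh \<beta>'\<close>, of ?V] by linarith
  ultimately show ?thesis using W_mean_pos by auto
qed

lemma unique_maximizer_in_uniqueness_regime: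
  assumes "(\<beta>, B) \<in> annealed_uniqueness_regime w"
  shows "\<exists>u. limiting_weight.unique_maximizer P W (sqrt (sinh \<beta> / expectation W)) B u"
proof -
  define r where "r = sqrt (sinh \<beta> / expectation W)"
  have \<beta>: "0 \<le> \<beta>" using assms by (auto simp: annealed_uniqueness_regime_def)
  interpret limiting_weight P W r unfolding r_def by (rule limiting_weight_coupling[OF \<beta>])
  have "\<exists>u. unique_maximizer B u"
  proof (cases "B = 0")
    case True
    with assms have "0 < \<beta>" "\<beta> < annealed_beta_c w" by (auto simp: annealed_uniqueness_regime_def)
    then have "r\<^sup>2 * expectation (\<lambda>x. (W x)\<^sup>2) < 1"
      using subcritical_coupling W_mean_pos \<beta> by (simp add: r_def coupling_square)
    with True unique_maximizer_subcritical show ?thesis by blast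
  qed (rule unique_maximizer_nonzero_field)
  then show ?thesis unfolding r_def .
qed

end

theorem theorem1p2:
  fixes w :: "nat \<Rightarrow> nat \<Rightarrow> real"
    and P :: "'a measure" and W :: "'a \<Rightarrow> real"
    and \<beta> B \<epsilon> :: real
  assumes "\<And>N i. 1 \<le> i \<Longrightarrow> i \<le> N \<Longrightarrow> w N i > 0"
    and "weight_regularity w P W"
    and "(\<beta>, B) \<in> annealed_uniqueness_regime w"
    and "\<epsilon> > 0"
  shows "\<exists>L>0. \<forall>\<^sub>F N in sequentially.
           measure (annealed_ising w \<beta> B N)
             {\<sigma> \<in> space (annealed_ising w \<beta> B N).
                \<bar>total_spin N \<sigma> / real N - annealed_magnetization w \<beta> B\<bar> \<ge> \<epsilon>}
           \<le> exp (- (real N * L))"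
proof -
  interpret regular_weights w P W using assms(1,2) by unfold_locales auto
  have \<beta>: "0 \<le> \<beta>" using assms(3) by (auto simp: annealed_uniqueness_regime_def)
  have space: "space (annealed_ising w \<beta> B N) = spin_configs N" for N
    by (simp add: annealed_ising_def space_point_measure)
  obtain u where u: "limiting_weight.unique_maximizer P W (sqrt (sinh \<beta> / expectation W)) B u"
    using unique_maximizer_in_uniqueness_regime[OF assms(3)] by blast
  show ?thesis
    unfolding space annealed_magnetization_eq[OF \<beta> u] by (rule annealed_concentration[OF \<beta> u assms(4)])
qed

end
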